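(* Let $m\ge 2$ be an integer, let $\delta>-m$ be real, and put $\tau=3+\delta/m$. Let $H$ be a connected directed graph on $k$ vertices such that the set $\Pi$ of orderings $\pi$ for which $(H,\pi)$ is attainable is nonempty. For $\pi\in\Pi$ define $$B(H,\pi)=\max_{s\in\{0,1,\dots,k\}}\Big(-s+\sum_{i=s+1}^{k}\beta(\pi^{-1}(i))\Big),\qquad \beta(x)=\frac{\tau-2}{\tau-1}\big(d^{\mathrm{(in)}}_H(x)-d^{\mathrm{(out)}}_H(x)\big)-d^{\mathrm{(in)}}_H(x),$$ let $B(H)=\max_{\pi\in\Pi}B(H,\pi)$, and let $r^*$ be the largest, among all $\pi\in\Pi$ with $B(H,\pi)=B(H)$, of the number of different $s\in\{0,\dots,k\}$ attaining the maximum defining $B(H,\pi)$. Then there exist constants $0<C_1\le C_2<\infty$ (not depending on $t$) such that $$C_1\le \liminf_{t\to\infty}\frac{\mathbb{E}[N_t(H)]}{t^{k+B(H)}\log^{r^*-1}(t)}\le \limsup_{t\to\infty}\frac{\mathbb{E}[N_t(H)]}{t^{k+B(H)}\log^{r^*-1}(t)}\le C_2 .$$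
   Context: Preferential attachment model $\mathrm{PA}_t=\mathrm{PA}_t(m,\delta)$: a growing random directed multigraph. $\mathrm{PA}_1$ is a single vertex $1$ without edges; $\mathrm{PA}_2$ has vertices $1,2$ and $m$ edges from $2$ to $1$. For $t\ge 3$, given $\mathrm{PA}_{t-1}$, a vertex $t$ is added with $m$ edges, labeled $j=1,\dots,m$, directed from $t$ to vertices $E_{t,1},\dots,E_{t,m}\in\{1,\dots,t-1\}$ chosen sequentially: conditionally on $\mathrm{PA}_{t-1}$ and the first $j-1$ edges of $t$, $$\mathbb{P}(E_{t,j}=i\mid \cdot)=\frac{D_i(t-1,j-1)+\delta}{2m(t-2)+(j-1)+(t-1)\delta},\qquad i\in\{1,\dots,t-1\},$$ where $D_i(t-1,j-1)$ is the (total) degree of $i$ after the first $j-1$ edges of $t$ have been attached. Multiple edges are allowed. For $t=2$ put $E_{2,j}=1$ for all $j$. A labeled edge is a triple $(u,v,j)$ with $u<v$, $j\in\{1,\dots,m\}$, directed from $v$ to $u$; it belongs to $E(\mathrm{PA}_t)$ iff $v\le t$ and $E_{v,j}=u$. An ordering of a directed graph $H$ on $k$ vertices is a bijection $\pi:V_H\to\{1,\dots,k\}$, prescribing the order of arrival ($\pi(x)<\pi(y)$ means $x$ is older than $y$). $(H,\pi)$ is attainable if every edge of $H$ goes from a newer to an older vertex (an edge $x\to y$ has $\pi(x)>\pi(y)$; in particular $H$ is acyclic) and all out-degrees in $H$ are at most $m$. $d^{\mathrm{(in)}}_H(x)$, $d^{\mathrm{(out)}}_H(x)$ are the in- and out-degree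 of $x$ in $H$. $N_t(H)$ is the total number of (labeled) copies of $H$ in $\mathrm{PA}_t$, for any ordering: pairs of a $k$-element vertex set $V\subseteq\{1,\dots,t\}$ and a set $M\subseteq E(\mathrm{PA}_t)$ of labeled edges between vertices of $V$ such that the directed graph $(V,M)$ (labels forgotten) is isomorphic to $H$. *)

theory Defs
  imports "HOL-Probability.Probability" "Graph_Theory.Digraph_Isomorphism"
begin

section \<open>The preferential attachment model\<close>

text \<open>
  A labeled edge \<open>(u, v, j)\<close> is the \<open>j\<close>-th edge of the vertex \<open>v\<close>, directed from \<open>v\<close> to the
  older vertex \<open>u\<close>. The argument \<open>e\<close> below gives the endpoints: \<open>e v j\<close> is the vertex to which
  the \<open>j\<close>-th edge of \<open>v\<close> is attached.

  \<open>pa_partial m e t j\<close> is the set of edges of the graph of size \<open>t\<close> together with the first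
  \<open>j\<close> edges of the vertex \<open>t + 1\<close>.
\<close>

definition pa_partial :: "nat \<Rightarrow> (nat \<Rightarrow> nat \<Rightarrow> nat) \<Rightarrow> nat \<Rightarrow> nat \<Rightarrow> (nat \<times> nat \<times> nat) set" where
  "pa_partial m e t j =
     {(u, v, l). u = e v l \<and> (v \<in> {2..t} \<and> l \<in> {1..m} \<or> v = t + 1 \<and> l \<in> {1..j})}"

abbreviation pa_edges :: "nat \<Rightarrow> (nat \<Rightarrow> nat \<Rightarrow> nat) \<Rightarrow> nat \<Rightarrow> (nat \<times> nat \<times> nat) set" where
  "pa_edges m e t \<equiv> pa_partial m e t 0"

definition total_degree :: "(nat \<times> nat \<times> nat) set \<Rightarrow> nat \<Rightarrow> nat" where
  "total_degree S i = card {(u, v, l) \<in> S. u = i} + card {(u, v, l) \<in> S. v = i}"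

text \<open>
  All graphs \<open>PA\<^sub>1, PA\<^sub>2, \<dots>\<close> live on one probability space. The random past is discrete, so
  conditioning on it is elementary conditioning on the events that the labeled edges
  present so far form a given set \<open>S\<close>.
\<close>

locale preferential_attachment = prob_space M for M :: "'w measure" +
  fixes m :: nat and \<delta> :: real and E :: "nat \<Rightarrow> nat \<Rightarrow> 'w \<Rightarrow> nat"
  assumes measurable_E: "\<And>t j. t \<ge> 2 \<Longrightarrow> j \<in> {1..m} \<Longrightarrow> E t j \<in> measurable M (count_space UNIV)"
    and E_older: "\<And>t j \<omega>. t \<ge> 2 \<Longrightarrow> j \<in> {1..m} \<Longrightarrow> \<omega> \<in> space M \<Longrightarrow> E t j \<omega> \<in> {1..t - 1}"
    and E_2: "\<And>j \<omega>. j \<in> {1..m} \<Longrightarrow> \<omega> \<in> space M \<Longrightarrow> E 2 j \<omega> = 1"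
    and attachment: "\<And>t j i S. t \<ge> 3 \<Longrightarrow> j \<in> {1..m} \<Longrightarrow> i \<in> {1..t - 1} \<Longrightarrow>
      \<P>(\<omega> in M. pa_partial m (\<lambda>v l. E v l \<omega>) (t - 1) (j - 1) = S) > 0 \<Longrightarrow>
      \<P>(\<omega> in M. E t j \<omega> = i \<bar> pa_partial m (\<lambda>v l. E v l \<omega>) (t - 1) (j - 1) = S) =
        (real (total_degree S i) + \<delta>)
          / (2 * real m * (real t - 2) + (real j - 1) + (real t - 1) * \<delta>)"

section \<open>Counting copies of a directed graph\<close>

text \<open>
  Forgetting labels, a set of labeled edges becomes a set of arcs, possibly parallel.
\<close>

definition edge_digraph :: "nat set \<Rightarrow> (nat \<times> nat \<times> nat) set \<Rightarrow> (nat, nat \<times> nat \<times> nat) pre_digraph"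
where
  "edge_digraph V A =
     \<lparr> verts = V, arcs = A, tail = (\<lambda>(u, v, j). v), head = (\<lambda>(u, v, j). u) \<rparr>"

definition copies ::
  "nat \<Rightarrow> (nat \<Rightarrow> nat \<Rightarrow> nat) \<Rightarrow> nat \<Rightarrow> ('a, 'b) pre_digraph \<Rightarrow> (nat set \<times> (nat \<times> nat \<times> nat) set) set"
where
  "copies m e t H = {(V, A). V \<subseteq> {1..t} \<and> card V = card (verts H) \<and>
     A \<subseteq> pa_edges m e t \<and> (\<forall>(u, v, j) \<in> A. u \<in> V \<and> v \<in> V) \<and>
     digraph_iso (edge_digraph V A) H}"

definition num_copies :: "nat \<Rightarrow> (nat \<Rightarrow> nat \<Rightarrow> nat) \<Rightarrow> nat \<Rightarrow> ('a, 'b) pre_digraph \<Rightarrow> nat" where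
  "num_copies m e t H = card (copies m e t H)"

section \<open>Orderings and exponents\<close>

text \<open>
  Orderings are bijections on the vertex set; extensionality makes each of them a single
  function of type \<open>'a \<Rightarrow> nat\<close>.
\<close>

definition orderings :: "('a, 'b) pre_digraph \<Rightarrow> ('a \<Rightarrow> nat) set" where
  "orderings H =
     {\<pi> \<in> extensional (verts H). bij_betw \<pi> (verts H) {1..card (verts H)}}"

definition attainable :: "nat \<Rightarrow> ('a, 'b) pre_digraph \<Rightarrow> ('a \<Rightarrow> nat) \<Rightarrow> bool" where
  "attainable m H \<pi> \<longleftrightarrow> (\<forall>a \<in> arcs H. \<pi> (tail H a) > \<pi> (head H a)) \<and>
     (\<forall>x \<in> verts H. out_degree H x \<le> m)"

definition attainable_orderings :: "nat \<Rightarrow> ('a, 'b) pre_digraph \<Rightarrow> ('a \<Rightarrow> nat) set" where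
  "attainable_orderings m H = {\<pi> \<in> orderings H. attainable m H \<pi>}"

definition beta :: "real \<Rightarrow> ('a, 'b) pre_digraph \<Rightarrow> 'a \<Rightarrow> real" where
  "beta \<tau> H x = (\<tau> - 2) / (\<tau> - 1) * (real (in_degree H x) - real (out_degree H x))
     - real (in_degree H x)"

definition B_term :: "real \<Rightarrow> ('a, 'b) pre_digraph \<Rightarrow> ('a \<Rightarrow> nat) \<Rightarrow> nat \<Rightarrow> real" where
  "B_term \<tau> H \<pi> s =
     - real s + (\<Sum>i = s + 1..card (verts H). beta \<tau> H (inv_into (verts H) \<pi> i))"

definition B_ord :: "real \<Rightarrow> ('a, 'b) pre_digraph \<Rightarrow> ('a \<Rightarrow> nat) \<Rightarrow> real" where
  "B_ord \<tau> H \<pi> = Max (B_term \<tau> H \<pi> ` {0..card (verts H)})"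

definition B_graph :: "nat \<Rightarrow> real \<Rightarrow> ('a, 'b) pre_digraph \<Rightarrow> real" where
  "B_graph m \<tau> H = Max (B_ord \<tau> H ` attainable_orderings m H)"

definition num_maximizers :: "real \<Rightarrow> ('a, 'b) pre_digraph \<Rightarrow> ('a \<Rightarrow> nat) \<Rightarrow> nat" where
  "num_maximizers \<tau> H \<pi> = card {s \<in> {0..card (verts H)}. B_term \<tau> H \<pi> s = B_ord \<tau> H \<pi>}"

definition r_star :: "nat \<Rightarrow> real \<Rightarrow> ('a, 'b) pre_digraph \<Rightarrow> nat" where
  "r_star m \<tau> H =
     Max (num_maximizers \<tau> H ` {\<pi> \<in> attainable_orderings m H. B_ord \<tau> H \<pi> = B_graph m \<tau> H})"

end

theory Submission
  imports Defs "HOL-Real_Asymp.Real_Asymp"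
begin

text \<open>
  The probability that a prescribed set of labeled edges is present has a closed form. Weight a
  state by the product, over the vertices \<open>i\<close>, of the rising factorials
  \<open>(D\<^sub>i + \<delta>) (D\<^sub>i + \<delta> + 1) \<dots> (D\<^sub>i + \<delta> + p\<^sub>i - 1)\<close>, where \<open>p\<^sub>i\<close> counts the prescribed edges that
  still have to attach to \<open>i\<close>. As in a Polya urn, a step with a free edge multiplies the expected
  weight by \<open>1 + (\<Sum> p\<^sub>i) / Z\<close>, and a step with a prescribed edge by \<open>1 / Z\<close>, where \<open>Z\<close> is the
  normalizing constant of that step. Since \<open>Z\<close> grows linearly with slope \<open>2 m + \<delta>\<close>, the resulting
  product is, up to constants, the product of \<open>u powr (- \<kappa>) * v powr (\<kappa> - 1)\<close> over the prescribed
  edges \<open>(u, v, j)\<close>, with \<open>\<kappa> = m / (2 m + \<delta>) = 1 / (\<tau> - 1)\<close>.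

  Copies of \<open>H\<close> are placements of \<open>H\<close> along increasing sequences \<open>u\<^sub>1 < \<dots> < u\<^sub>k \<le> t\<close>, one family for
  each attainable ordering. So the expected number of copies is comparable to a sum of the products
  of \<open>u\<^sub>i powr \<beta>\<^sub>i\<close>. Summing out the largest index last, each summation raises the exponent by
  \<open>1 + \<beta>\<^sub>i\<close>, resets it to zero when it becomes negative, and contributes a logarithm when it is
  exactly zero; unfolding this recursion gives the maximum over \<open>s\<close> and the number of maximizers.
\<close>

section \<open>The probability of a set of labeled edges\<close>

text \<open>The weight is built so that its conditional expectation after one step is a
  deterministic multiple of its present value: attaching to a vertex with probability proportional
  to \<open>x = D + \<delta>\<close> turns the rising factorial of \<open>x\<close> into that of
  \<open>x + 1\<close>, and \<open>x\<close> times the latter is the former times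
  \<open>x + p\<close>. The probabilities are summed over all placements of H, so an asymptotic
  statement for one fixed set of edges would not do. Every estimate is two-sided, with constants
  that depend on the prescribed set only through a bound K on its size. Logarithms make this
  possible: each replacement (ln (1 + x) by x, Z by its leading term, 1 / n by an increment of ln)
  costs O(1 / n^2) per vertex, hence a bounded amount altogether. Placements overcount copies,
  through symmetries of H and labels of parallel arcs. Counting is therefore two-sided as well: one
  fixed ordering and labeling gives distinct copies, and all of them together give every
  copy.\<close>

lemma pa_partial_Suc:
  "pa_partial m e n (Suc j) = insert (e (Suc n) (Suc j), Suc n, Suc j) (pa_partial m e n j)"
  unfolding pa_partial_def by (auto simp: le_Suc_eq)

lemma pa_partial_full: "n \<ge> 1 \<Longrightarrow> pa_partial m e n m = pa_edges m e (Suc n)"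
  unfolding pa_partial_def by (auto simp: le_Suc_eq)

text \<open>Restricting to \<open>x \<noteq> v\<close> fits the urn: while vertex
  \<open>n + 1\<close> attaches its edges, only the degrees of the vertices up to \<open>n\<close>
  enter the weight and the probabilities.\<close>

lemma total_degree_insert:
  assumes "finite S" "(i, v, l) \<notin> S" "x \<noteq> v"
  shows "total_degree (insert (i, v, l) S) x = total_degree S x + of_bool (i = x)"
proof -
  have "{(u, w, k) \<in> insert (i, v, l) S. w = x} = {(u, w, k) \<in> S. w = x}"
    using assms by auto
  moreover have "{(u, w, k) \<in> insert (i, v, l) S. u = x} =
      (if i = x then insert (i, v, l) {(u, w, k) \<in> S. u = x} else {(u, w, k) \<in> S. u = x})"
    by auto
  moreover have "finite {(u, w, k) \<in> S. u = x}"
    by (rule finite_subset[OF _ \<open>finite S\<close>]) auto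
  moreover have "(i, v, l) \<notin> {(u, w, k) \<in> S. u = x}"
    using assms by auto
  ultimately show ?thesis
    unfolding total_degree_def by (cases "i = x") simp_all
qed

lemma pochhammer_shift:
  fixes x :: real
  shows "x * pochhammer (x + 1) p = pochhammer x p * (x + real p)"
  by (metis pochhammer_Suc pochhammer_rec)

text \<open>Step with a free edge: attachment weight of \<open>i\<close> times the new urn weight.
  Summing the right side over \<open>i\<close> gives the old weight times the normalization plus the
  number of pending edges.\<close>

lemma prod_pochhammer_shift:
  fixes x :: "nat \<Rightarrow> real"
  assumes "finite I" "i \<in> I"
  shows "x i * (\<Prod>k\<in>I. pochhammer (x k + of_bool (i = k)) (p k)) =
    (\<Prod>k\<in>I. pochhammer (x k) (p k)) * (x i + real (p i))"
proof -
  have "(\<Prod>k\<in>I - {i}. pochhammer (x k + of_bool (i = k)) (p k)) =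
      (\<Prod>k\<in>I - {i}. pochhammer (x k) (p k))"
    by (rule prod.cong) auto
  then show ?thesis
    using pochhammer_shift[of "x i" "p i"]
    by (simp add: prod.remove[OF assms] mult_ac)
qed

text \<open>Step with a prescribed edge to \<open>i\<close>: the attachment weight supplies the
  first factor of a rising factorial that is longer by one, which is the weight before the step,
  when that edge was still pending.\<close>

lemma prod_pochhammer_shift_Suc:
  fixes x :: "nat \<Rightarrow> real"
  assumes "finite I" "i \<in> I"
  shows "x i * (\<Prod>k\<in>I. pochhammer (x k + of_bool (i = k)) (p k)) =
    (\<Prod>k\<in>I. pochhammer (x k) (p k + of_bool (i = k)))"
proof -
  have "(\<Prod>k\<in>I - {i}. pochhammer (x k + of_bool (i = k)) (p k)) =
      (\<Prod>k\<in>I - {i}. pochhammer (x k) (p k + of_bool (i = k)))"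
    by (rule prod.cong) auto
  then show ?thesis
    by (simp add: prod.remove[OF assms] pochhammer_rec mult_ac)
qed

text \<open>
  Steps are indexed by the state they start from: step \<open>(n, j)\<close> attaches the edge \<open>j + 1\<close> of the
  vertex \<open>n + 1\<close>.
\<close>

definition attach_norm :: "nat \<Rightarrow> real \<Rightarrow> nat \<Rightarrow> nat \<Rightarrow> real" where
  "attach_norm m \<delta> n j = 2 * real m * (real n - 1) + real j + real n * \<delta>"

text \<open>Injectivity of \<open>snd\<close> says that a slot \<open>(v, l)\<close> has at most one
  prescribed endpoint; two different ones would make the event impossible.\<close>

definition valid_edges :: "nat \<Rightarrow> (nat \<times> nat \<times> nat) set \<Rightarrow> bool" where
  "valid_edges m R \<longleftrightarrow> finite R \<and> (\<forall>(u, v, l) \<in> R. 1 \<le> u \<and> u < v \<and> l \<in> {1..m}) \<and> inj_on snd R"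

definition later_edges :: "(nat \<times> nat \<times> nat) set \<Rightarrow> nat \<Rightarrow> nat \<Rightarrow> (nat \<times> nat \<times> nat) set" where
  "later_edges R n j = {(u, v, l) \<in> R. v > Suc n \<or> v = Suc n \<and> l > j}"

text \<open>This may be positive for vertices \<open>i > n\<close> that do not exist yet. They enter
  the urn weight only at their birth, with all their prescribed in-edges still pending.\<close>

definition pending :: "(nat \<times> nat \<times> nat) set \<Rightarrow> nat \<Rightarrow> nat \<Rightarrow> nat \<Rightarrow> nat" where
  "pending R n j i = card {e \<in> later_edges R n j. fst e = i}"

text \<open>\<open>R - later_edges R n j\<close> consists of the prescribed edges whose slot has
  already been filled; the indicator kills every history in which one of them was missed.\<close>

definition urn_weight ::
  "real \<Rightarrow> (nat \<times> nat \<times> nat) set \<Rightarrow> nat \<Rightarrow> nat \<Rightarrow> (nat \<times> nat \<times> nat) set \<Rightarrow> real" where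
  "urn_weight \<delta> R n j S = of_bool (R - later_edges R n j \<subseteq> S) *
     (\<Prod>i=1..n. pochhammer (real (total_degree S i) + \<delta>) (pending R n j i))"

definition step_factor :: "nat \<Rightarrow> real \<Rightarrow> (nat \<times> nat \<times> nat) set \<Rightarrow> nat \<Rightarrow> nat \<Rightarrow> real" where
  "step_factor m \<delta> R n j =
     (if (Suc n, Suc j) \<in> snd ` R then 1 / attach_norm m \<delta> n j
      else 1 + real (\<Sum>i=1..n. pending R n j i) / attach_norm m \<delta> n j)"

lemma later_edges_Suc_required:
  assumes "valid_edges m R" "(u, Suc n, Suc j) \<in> R"
  shows "later_edges R n j = insert (u, Suc n, Suc j) (later_edges R n (Suc j))"
    "(u, Suc n, Suc j) \<notin> later_edges R n (Suc j)"
proof -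
  have iff: "(x, Suc n, Suc j) \<in> R \<longleftrightarrow> x = u" for x
    using assms inj_onD[of snd R "(x, Suc n, Suc j)" "(u, Suc n, Suc j)"]
    by (auto simp: valid_edges_def)
  have "(x, v, l) \<in> later_edges R n j \<longleftrightarrow>
      (x, v, l) \<in> insert (u, Suc n, Suc j) (later_edges R n (Suc j))" for x v l
    unfolding later_edges_def
    by (cases "l = Suc j"; cases "v = Suc n") (auto simp: iff)
  then show "later_edges R n j = insert (u, Suc n, Suc j) (later_edges R n (Suc j))"
    by (simp only: set_eq_iff split_paired_All) blast
qed (auto simp: later_edges_def)

lemma later_edges_Suc_free:
  assumes "(Suc n, Suc j) \<notin> snd ` R"
  shows "later_edges R n j = later_edges R n (Suc j)"
  using assms unfolding later_edges_def
  by (auto simp: image_iff less_Suc_eq)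

lemma finite_later_edges: "finite R \<Longrightarrow> finite (later_edges R n j)"
  unfolding later_edges_def by (erule finite_subset[rotated]) auto

text \<open>Labels never exceed \<open>m\<close>, so completing vertex \<open>n + 1\<close> and
  starting vertex \<open>n + 2\<close> is a mere change of index for the prescribed edges.\<close>

lemma later_edges_full:
  assumes "valid_edges m R"
  shows "later_edges R n m = later_edges R (Suc n) 0"
  using assms unfolding later_edges_def valid_edges_def
  by (intro Collect_cong) (auto simp: Suc_le_eq less_Suc_eq)

section \<open>Histories as random variables with finitely many values\<close>

locale pa_parameters =
  fixes m :: nat and \<delta> :: real
  assumes m_pos: "m \<ge> 1" and \<delta>_gt: "\<delta> > - real m"

locale pa_model = preferential_attachment + pa_parameters
begin

definition hist :: "nat \<Rightarrow> nat \<Rightarrow> 'a \<Rightarrow> (nat \<times> nat \<times> nat) set" where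
  "hist n j \<omega> = pa_partial m (\<lambda>v l. E v l \<omega>) n j"

text \<open>A finite universe for all histories of size \<open>n\<close>, including the partially
  attached vertex \<open>n + 1\<close>. It turns expectations into finite sums over subsets, which
  elementary conditioning can handle.\<close>

definition edge_box :: "nat \<Rightarrow> (nat \<times> nat \<times> nat) set" where
  "edge_box n = {1..n} \<times> {2..Suc n} \<times> {1..m}"

lemma finite_edge_box: "finite (Pow (edge_box n))"
  by (simp add: edge_box_def)

lemma hist_subset:
  assumes "n \<ge> 1" "j \<le> m" "\<omega> \<in> space M"
  shows "hist n j \<omega> \<subseteq> edge_box n"
proof safe
  fix u v l assume "(u, v, l) \<in> hist n j \<omega>"
  then have *: "u = E v l \<omega>" "v \<in> {2..Suc n}" "l \<in> {1..m}"
    using assms unfolding hist_def pa_partial_def by auto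
  moreover have "u \<in> {1..v - 1}"
    using * assms E_older[of v l \<omega>] by auto
  ultimately show "(u, v, l) \<in> edge_box n"
    unfolding edge_box_def by auto
qed

lemma hist_Suc: "hist n (Suc j) \<omega> = insert (E (Suc n) (Suc j) \<omega>, Suc n, Suc j) (hist n j \<omega>)"
  unfolding hist_def by (rule pa_partial_Suc)

lemma hist_full: "n \<ge> 1 \<Longrightarrow> hist n m \<omega> = hist (Suc n) 0 \<omega>"
  unfolding hist_def by (rule pa_partial_full)

text \<open>Inside the finite box, equality with \<open>S\<close> is a finite conjunction of
  membership conditions, each a condition on a single \<open>E v l\<close>; outside the box the
  event is empty.\<close>

lemma hist_sets:
  assumes "n \<ge> 1" "j \<le> m"
  shows "{\<omega> \<in> space M. hist n j \<omega> = S} \<in> sets M"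
proof (cases "S \<subseteq> edge_box n")
  case True
  have "{\<omega> \<in> space M. hist n j \<omega> = S} =
    {\<omega> \<in> space M. \<forall>e\<in>edge_box n. (e \<in> hist n j \<omega>) = (e \<in> S)}"
    using hist_subset[OF assms] True by blast
  moreover have "{\<omega> \<in> space M. (e \<in> hist n j \<omega>) = (e \<in> S)} \<in> sets M" if "e \<in> edge_box n" for e
  proof -
    obtain u v l where e: "e = (u, v, l)" by (cases e)
    then have [measurable]: "E v l \<in> measurable M (count_space UNIV)"
      using that measurable_E[of v l] by (auto simp: edge_box_def)
    have "{\<omega> \<in> space M. (e \<in> hist n j \<omega>) = (e \<in> S)} = {\<omega> \<in> space M.
        (u = E v l \<omega> \<and> (v \<in> {2..n} \<and> l \<in> {1..m} \<or> v = n + 1 \<and> l \<in> {1..j})) = ((u, v, l) \<in> S)}"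
      unfolding e hist_def pa_partial_def by auto
    then show ?thesis by simp
  qed
  ultimately show ?thesis
    using finite_edge_box by (auto intro!: sets.sets_Collect_finite_All)
next
  case False
  then have *: "{\<omega> \<in> space M. hist n j \<omega> = S} = {}"
    using hist_subset[OF assms] by blast
  show ?thesis unfolding * by simp
qed

lemma hist_expand:
  fixes f :: "(nat \<times> nat \<times> nat) set \<Rightarrow> real"
  assumes "n \<ge> 1" "j \<le> m" "\<omega> \<in> space M"
  shows "f (hist n j \<omega>) =
    (\<Sum>S\<in>Pow (edge_box n). f S * indicator {\<omega> \<in> space M. hist n j \<omega> = S} \<omega>)"
proof -
  have "(\<Sum>S\<in>Pow (edge_box n). f S * indicator {\<omega> \<in> space M. hist n j \<omega> = S} \<omega>) =
     (\<Sum>S\<in>Pow (edge_box n). if S = hist n j \<omega> then f S else 0)"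
    using assms by (intro sum.cong) (auto simp: indicator_def)
  then show ?thesis
    using hist_subset[OF assms] finite_edge_box by simp
qed

lemma integrable_hist:
  fixes f :: "(nat \<times> nat \<times> nat) set \<Rightarrow> real"
  assumes "n \<ge> 1" "j \<le> m"
  shows "integrable M (\<lambda>\<omega>. f (hist n j \<omega>))"
proof -
  have "integrable M (\<lambda>\<omega>. \<Sum>S\<in>Pow (edge_box n).
      f S * indicator {\<omega> \<in> space M. hist n j \<omega> = S} \<omega>)"
    using hist_sets[OF assms]
    by (intro Bochner_Integration.integrable_sum integrable_real_mult_indicator) auto
  then show ?thesis
    by (subst Bochner_Integration.integrable_cong[OF refl hist_expand[OF assms]]) auto
qed

lemma expectation_hist:
  fixes f :: "(nat \<times> nat \<times> nat) set \<Rightarrow> real"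
  assumes "n \<ge> 1" "j \<le> m"
  shows "expectation (\<lambda>\<omega>. f (hist n j \<omega>)) =
    (\<Sum>S\<in>Pow (edge_box n). prob {\<omega> \<in> space M. hist n j \<omega> = S} * f S)"
proof -
  have "expectation (\<lambda>\<omega>. f (hist n j \<omega>)) = expectation (\<lambda>\<omega>. \<Sum>S\<in>Pow (edge_box n).
      f S * indicator {\<omega> \<in> space M. hist n j \<omega> = S} \<omega>)"
    using hist_expand[OF assms] by (intro Bochner_Integration.integral_cong) auto
  also have "\<dots> = (\<Sum>S\<in>Pow (edge_box n). expectation (\<lambda>\<omega>.
      f S * indicator {\<omega> \<in> space M. hist n j \<omega> = S} \<omega>))"
    using hist_sets[OF assms]
    by (intro Bochner_Integration.integral_sum integrable_real_mult_indicator) auto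
  also have "\<dots> = (\<Sum>S\<in>Pow (edge_box n). prob {\<omega> \<in> space M. hist n j \<omega> = S} * f S)"
    using hist_sets[OF assms] by (intro sum.cong) (simp_all add: mult.commute)
  finally show ?thesis .
qed

text \<open>The product form of the conditional law also covers null histories, where both sides
  vanish.\<close>

lemma prob_hist_next:
  assumes "n \<ge> 2" "j < m" "i \<in> {1..n}"
  shows "prob {\<omega> \<in> space M. hist n j \<omega> = S \<and> E (Suc n) (Suc j) \<omega> = i} =
    prob {\<omega> \<in> space M. hist n j \<omega> = S} *
      ((real (total_degree S i) + \<delta>) / attach_norm m \<delta> n j)"
proof (cases "prob {\<omega> \<in> space M. hist n j \<omega> = S} > 0")
  case True
  have "\<P>(\<omega> in M. E (Suc n) (Suc j) \<omega> = i \<bar> hist n j \<omega> = S) =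
      (real (total_degree S i) + \<delta>) / attach_norm m \<delta> n j"
    using attachment[of "Suc n" "Suc j" i S] assms True unfolding hist_def attach_norm_def by auto
  moreover have "{\<omega> \<in> space M. hist n j \<omega> = S \<and> E (Suc n) (Suc j) \<omega> = i} =
      {\<omega> \<in> space M. E (Suc n) (Suc j) \<omega> = i \<and> hist n j \<omega> = S}" by auto
  ultimately show ?thesis
    using True unfolding cond_prob_def by (simp add: field_simps)
next
  case False
  then have 0: "prob {\<omega> \<in> space M. hist n j \<omega> = S} = 0"
    using measure_nonneg[of M] by (simp add: order.antisym not_less)
  moreover have "prob {\<omega> \<in> space M. hist n j \<omega> = S \<and> E (Suc n) (Suc j) \<omega> = i} \<le>
      prob {\<omega> \<in> space M. hist n j \<omega> = S}"
    using assms by (intro finite_measure_mono hist_sets) auto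
  ultimately show ?thesis
    using measure_nonneg[of M "{\<omega> \<in> space M. hist n j \<omega> = S \<and> E (Suc n) (Suc j) \<omega> = i}"] by simp
qed

lemma hist_next_sets:
  assumes "n \<ge> 1" "j < m"
  shows "{\<omega> \<in> space M. hist n j \<omega> = S \<and> E (Suc n) (Suc j) \<omega> = i} \<in> sets M"
proof -
  have [measurable]: "E (Suc n) (Suc j) \<in> measurable M (count_space UNIV)"
    using assms by (intro measurable_E) auto
  have "{\<omega> \<in> space M. hist n j \<omega> = S \<and> E (Suc n) (Suc j) \<omega> = i} =
      {\<omega> \<in> space M. hist n j \<omega> = S} \<inter> {\<omega> \<in> space M. E (Suc n) (Suc j) \<omega> = i}" by auto
  also have "\<dots> \<in> sets M"
    using assms by (intro sets.Int hist_sets) auto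
  finally show ?thesis .
qed

text \<open>Total probability yields the normalization without counting degrees.\<close>

lemma sum_attachment:
  assumes "n \<ge> 2" "j < m" "prob {\<omega> \<in> space M. hist n j \<omega> = S} > 0"
  shows "(\<Sum>i=1..n. (real (total_degree S i) + \<delta>) / attach_norm m \<delta> n j) = 1"
proof -
  let ?A = "\<lambda>i. {\<omega> \<in> space M. hist n j \<omega> = S \<and> E (Suc n) (Suc j) \<omega> = i}"
  have "E (Suc n) (Suc j) \<omega> \<in> {1..n}" if "\<omega> \<in> space M" for \<omega>
    using E_older[of "Suc n" "Suc j" \<omega>] assms that by auto
  then have "{\<omega> \<in> space M. hist n j \<omega> = S} = (\<Union>i\<in>{1..n}. ?A i)" by auto
  then have "prob {\<omega> \<in> space M. hist n j \<omega> = S} = prob (\<Union>i\<in>{1..n}. ?A i)" by simp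
  also have "\<dots> = (\<Sum>i=1..n. prob (?A i))"
    using assms hist_next_sets[of n j]
    by (intro finite_measure_finite_Union) (auto simp: disjoint_family_on_def)
  also have "\<dots> = prob {\<omega> \<in> space M. hist n j \<omega> = S} *
      (\<Sum>i=1..n. (real (total_degree S i) + \<delta>) / attach_norm m \<delta> n j)"
    unfolding sum_distrib_left using assms by (intro sum.cong prob_hist_next) auto
  finally show ?thesis
    using assms(3) by simp
qed

text \<open>Law of total expectation over the history and the endpoint of the next edge. The bound
  \<open>n \<ge> 2\<close> reflects that the attachment rule starts with vertex 3.\<close>

lemma expectation_hist_Suc:
  fixes f :: "(nat \<times> nat \<times> nat) set \<Rightarrow> real"
  assumes "n \<ge> 2" "j < m"
  shows "expectation (\<lambda>\<omega>. f (hist n (Suc j) \<omega>)) =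
    (\<Sum>S\<in>Pow (edge_box n). prob {\<omega> \<in> space M. hist n j \<omega> = S} *
      (\<Sum>i=1..n. (real (total_degree S i) + \<delta>) / attach_norm m \<delta> n j *
         f (insert (i, Suc n, Suc j) S)))"
proof -
  let ?A = "\<lambda>S i. {\<omega> \<in> space M. hist n j \<omega> = S \<and> E (Suc n) (Suc j) \<omega> = i}"
  have eq: "f (hist n (Suc j) \<omega>) = (\<Sum>S\<in>Pow (edge_box n). \<Sum>i=1..n.
      f (insert (i, Suc n, Suc j) S) * indicator (?A S i) \<omega>)" if "\<omega> \<in> space M" for \<omega>
  proof -
    let ?e = "E (Suc n) (Suc j) \<omega>"
    have "?e \<in> {1..n}"
      using E_older[of "Suc n" "Suc j" \<omega>] assms that by auto
    moreover have "hist n j \<omega> \<in> Pow (edge_box n)"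
      using hist_subset[of n j \<omega>] assms that by auto
    moreover have "(\<Sum>S\<in>Pow (edge_box n). \<Sum>i=1..n.
        f (insert (i, Suc n, Suc j) S) * indicator (?A S i) \<omega>) =
      (\<Sum>S\<in>Pow (edge_box n). if S = hist n j \<omega> then
         (\<Sum>i=1..n. if i = ?e then f (insert (i, Suc n, Suc j) S) else 0) else 0)"
      using that by (intro sum.cong) (auto simp: indicator_def intro!: sum.cong)
    ultimately show ?thesis
      using finite_edge_box by (simp add: hist_Suc)
  qed
  have int: "integrable M (\<lambda>\<omega>. f (insert (i, Suc n, Suc j) S) * indicator (?A S i) \<omega>)" for S i
    using assms hist_next_sets[of n j] by (intro integrable_real_mult_indicator) auto
  have "expectation (\<lambda>\<omega>. f (hist n (Suc j) \<omega>)) = expectation (\<lambda>\<omega>.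
      \<Sum>S\<in>Pow (edge_box n). \<Sum>i=1..n. f (insert (i, Suc n, Suc j) S) * indicator (?A S i) \<omega>)"
    using eq by (intro Bochner_Integration.integral_cong) auto
  also have "\<dots> = (\<Sum>S\<in>Pow (edge_box n). \<Sum>i=1..n.
      expectation (\<lambda>\<omega>. f (insert (i, Suc n, Suc j) S) * indicator (?A S i) \<omega>))"
    by (simp only: Bochner_Integration.integral_sum int Bochner_Integration.integrable_sum)
  also have "\<dots> = (\<Sum>S\<in>Pow (edge_box n). \<Sum>i=1..n. f (insert (i, Suc n, Suc j) S) * prob (?A S i))"
    using assms hist_next_sets[of n j] by (intro sum.cong refl) simp
  also have "\<dots> = (\<Sum>S\<in>Pow (edge_box n). prob {\<omega> \<in> space M. hist n j \<omega> = S} *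
      (\<Sum>i=1..n. (real (total_degree S i) + \<delta>) / attach_norm m \<delta> n j *
         f (insert (i, Suc n, Suc j) S)))"
    using prob_hist_next[OF assms]
    by (intro sum.cong refl) (simp add: sum_distrib_left mult_ac)
  finally show ?thesis .
qed

end

lemma pending_Suc_required:
  assumes "valid_edges m R" "(u, Suc n, Suc j) \<in> R"
  shows "pending R n j k = pending R n (Suc j) k + of_bool (u = k)"
proof -
  have "{e \<in> later_edges R n j. fst e = k} =
      (if u = k then insert (u, Suc n, Suc j) {e \<in> later_edges R n (Suc j). fst e = k}
       else {e \<in> later_edges R n (Suc j). fst e = k})"
    unfolding later_edges_Suc_required(1)[OF assms] by auto
  moreover have "finite {e \<in> later_edges R n (Suc j). fst e = k}"
    using assms finite_later_edges[of R n "Suc j"] by (simp add: valid_edges_def)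
  ultimately show ?thesis
    using later_edges_Suc_required(2)[OF assms] unfolding pending_def by (cases "u = k") simp_all
qed

text \<open>An edge into \<open>i\<close> comes from a vertex \<open>v > i \<ge> 2\<close>, so none
  of these slots is filled at the birth of \<open>i\<close>, and none was in state
  \<open>(2, 0)\<close> either. This lets the final formula refer to the single state
  \<open>(2, 0)\<close>.\<close>

lemma pending_self:
  assumes "valid_edges m R" "i \<ge> 2"
  shows "pending R i 0 i = pending R 2 0 i"
proof -
  have "{e \<in> later_edges R i 0. fst e = i} = {e \<in> later_edges R 2 0. fst e = i}"
    using assms unfolding later_edges_def valid_edges_def by fastforce
  then show ?thesis by (simp add: pending_def)
qed

section \<open>Evolution of the expected urn weight\<close>

context pa_model
begin

lemma fresh_hist:
  assumes "n \<ge> 1" "j \<le> m" "\<omega> \<in> space M"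
  shows "finite (hist n j \<omega>)" "(i, Suc n, Suc j) \<notin> hist n j \<omega>"
proof -
  show "finite (hist n j \<omega>)"
    using finite_subset[OF hist_subset[OF assms]] by (simp add: edge_box_def)
  show "(i, Suc n, Suc j) \<notin> hist n j \<omega>"
    unfolding hist_def pa_partial_def by auto
qed

text \<open>The one-step identity, conditional on the history \<open>S\<close>. Positive probability
  is needed because the normalization of the attachment weights is obtained from total probability,
  hence only for histories that occur.\<close>

lemma sum_urn_weight_insert:
  assumes R: "valid_edges m R" and n: "n \<ge> 2" "j < m"
    and pos: "prob {\<omega> \<in> space M. hist n j \<omega> = S} > 0"
  shows "(\<Sum>i=1..n. (real (total_degree S i) + \<delta>) / attach_norm m \<delta> n j *
      urn_weight \<delta> R n (Suc j) (insert (i, Suc n, Suc j) S)) =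
    step_factor m \<delta> R n j * urn_weight \<delta> R n j S"
proof -
  \<comment> \<open>A sample point realizing \<open>S\<close> transfers to \<open>S\<close> that it
    is finite and does not yet contain an edge in the next slot.\<close>
  obtain \<omega> where \<omega>: "\<omega> \<in> space M" "hist n j \<omega> = S"
  proof -
    have "{\<omega> \<in> space M. hist n j \<omega> = S} \<noteq> {}"
      using pos by (metis measure_empty less_irrefl)
    then show ?thesis using that by auto
  qed
  have fin: "finite S" and fresh: "\<And>i. (i, Suc n, Suc j) \<notin> S"
    using fresh_hist[of n j \<omega>] n \<omega> by auto
  define x where "x i = real (total_degree S i) + \<delta>" for i
  define z where "z = attach_norm m \<delta> n j"
  define p where "p = pending R n (Suc j)"
  have sum_x: "(\<Sum>i=1..n. x i / z) = 1"
    using sum_attachment[OF n pos] by (simp add: x_def z_def)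
  have w: "urn_weight \<delta> R n (Suc j) (insert (i, Suc n, Suc j) S) =
      of_bool (R - later_edges R n (Suc j) \<subseteq> insert (i, Suc n, Suc j) S) *
      (\<Prod>k=1..n. pochhammer (x k + of_bool (i = k)) (p k))" for i
    unfolding urn_weight_def p_def x_def using fin fresh
    by (intro arg_cong2[where f = "(*)"] prod.cong refl)
       (auto simp: total_degree_insert algebra_simps)
  show ?thesis
  proof (cases "(Suc n, Suc j) \<in> snd ` R")
    case False
    then have later: "later_edges R n (Suc j) = later_edges R n j"
      using later_edges_Suc_free by metis
    define b :: real where "b = of_bool (R - later_edges R n j \<subseteq> S)"
    \<comment> \<open>The new edge fills a slot that no prescribed edge uses, so it cannot help to
      cover the prescribed edges.\<close>
    have "(R - later_edges R n (Suc j) \<subseteq> insert (i, Suc n, Suc j) S) \<longleftrightarrow>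
        R - later_edges R n j \<subseteq> S" for i
      using False unfolding later by force
    then have "x i / z * urn_weight \<delta> R n (Suc j) (insert (i, Suc n, Suc j) S) =
        b * (\<Prod>k=1..n. pochhammer (x k) (p k)) * (x i / z + real (p i) / z)"
      if "i \<in> {1..n}" for i
      using prod_pochhammer_shift[of "{1..n}" i x p] that unfolding w b_def
      by (simp add: field_simps add_divide_distrib)
    then have "(\<Sum>i=1..n. x i / z * urn_weight \<delta> R n (Suc j) (insert (i, Suc n, Suc j) S)) =
        (\<Sum>i=1..n. b * (\<Prod>k=1..n. pochhammer (x k) (p k)) * (x i / z + real (p i) / z))"
      by (intro sum.cong) auto
    also have "\<dots> = b * (\<Prod>k=1..n. pochhammer (x k) (p k)) * (1 + real (\<Sum>i=1..n. p i) / z)"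
      by (simp only: sum_distrib_left[symmetric] sum.distrib sum_x of_nat_sum sum_divide_distrib)
    also have "\<dots> = step_factor m \<delta> R n j * urn_weight \<delta> R n j S"
      using False unfolding step_factor_def urn_weight_def b_def p_def x_def z_def pending_def later
      by simp
    finally show ?thesis by (simp add: x_def z_def)
  next
    case True
    then obtain u where u: "(u, Suc n, Suc j) \<in> R" by auto
    then have u_n: "u \<in> {1..n}"
      using R by (auto simp: valid_edges_def)
    define b :: real where "b = of_bool (R - later_edges R n j \<subseteq> S)"
    note later = later_edges_Suc_required[OF R u]
    have pend: "pending R n j = (\<lambda>k. p k + of_bool (u = k))"
      using pending_Suc_required[OF R u] by (auto simp: p_def)
    \<comment> \<open>The slot now belongs to the prescribed edge with endpoint \<open>u\<close>, so
      every other endpoint makes the indicator vanish and a single summand survives.\<close>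
    have "(R - later_edges R n (Suc j) \<subseteq> insert (i, Suc n, Suc j) S) \<longleftrightarrow>
        i = u \<and> R - later_edges R n j \<subseteq> S" for i
    proof -
      have "R - later_edges R n (Suc j) = insert (u, Suc n, Suc j) (R - later_edges R n j)"
        using u later by auto
      moreover have "(i, Suc n, Suc j) \<notin> R - later_edges R n j"
        unfolding later_edges_def by auto
      ultimately show ?thesis using fresh by auto
    qed
    then have "(\<Sum>i=1..n. x i / z * urn_weight \<delta> R n (Suc j) (insert (i, Suc n, Suc j) S)) =
        (\<Sum>i=1..n. if i = u then
           x u / z * (b * (\<Prod>k=1..n. pochhammer (x k + of_bool (u = k)) (p k))) else 0)"
      unfolding w b_def by (intro sum.cong) auto
    also have "\<dots> = b / z * (x u * (\<Prod>k=1..n. pochhammer (x k + of_bool (u = k)) (p k)))"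
      using u_n by simp
    also have "\<dots> = b / z * (\<Prod>k=1..n. pochhammer (x k) (p k + of_bool (u = k)))"
      using u_n by (subst prod_pochhammer_shift_Suc) auto
    also have "\<dots> = step_factor m \<delta> R n j * urn_weight \<delta> R n j S"
      using True unfolding step_factor_def urn_weight_def b_def pend x_def z_def by simp
    finally show ?thesis by (simp add: x_def z_def)
  qed
qed

lemma expectation_urn_weight_Suc:
  assumes "valid_edges m R" "n \<ge> 2" "j < m"
  shows "expectation (\<lambda>\<omega>. urn_weight \<delta> R n (Suc j) (hist n (Suc j) \<omega>)) =
    step_factor m \<delta> R n j * expectation (\<lambda>\<omega>. urn_weight \<delta> R n j (hist n j \<omega>))"
proof -
  have "n \<ge> 1" "j \<le> m" using assms by auto
  show ?thesis
    unfolding expectation_hist_Suc[OF assms(2,3)] expectation_hist[OF \<open>n \<ge> 1\<close> \<open>j \<le> m\<close>]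
      sum_distrib_left
  proof (intro sum.cong refl, unfold sum_distrib_left[symmetric])
    \<comment> \<open>A null history contributes 0 on both sides, so the one-step identity is needed
      only where it has been shown.\<close>
    fix S
    show "prob {\<omega> \<in> space M. hist n j \<omega> = S} *
        (\<Sum>i=1..n. (real (total_degree S i) + \<delta>) / attach_norm m \<delta> n j *
          urn_weight \<delta> R n (Suc j) (insert (i, Suc n, Suc j) S)) =
      step_factor m \<delta> R n j * (prob {\<omega> \<in> space M. hist n j \<omega> = S} * urn_weight \<delta> R n j S)"
      using sum_urn_weight_insert[OF assms, of S] measure_nonneg[of M]
      by (cases "prob {\<omega> \<in> space M. hist n j \<omega> = S} = 0") (auto simp: order_less_le)
  qed
qed

lemma total_degree_hist_new:
  assumes "n \<ge> 1" "\<omega> \<in> space M"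
  shows "total_degree (hist (Suc n) 0 \<omega>) (Suc n) = m"
proof -
  have older: "E v l \<omega> < v" if "v \<ge> 2" "l \<in> {1..m}" for v l
    using E_older[OF that assms(2)] that by auto
  have "{(u, v, l) \<in> hist (Suc n) 0 \<omega>. u = Suc n} = {}"
    using older unfolding hist_def pa_partial_def by fastforce
  moreover have "{(u, v, l) \<in> hist (Suc n) 0 \<omega>. v = Suc n} =
      (\<lambda>l. (E (Suc n) l \<omega>, Suc n, l)) ` {1..m}"
    using assms unfolding hist_def pa_partial_def by auto
  moreover have "card ((\<lambda>l. (E (Suc n) l \<omega>, Suc n, l)) ` {1..m}) = m"
    by (subst card_image) (auto simp: inj_on_def)
  ultimately show ?thesis
    unfolding total_degree_def by (simp only: card.empty add_0 add_0_right)
qed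

text \<open>A newborn vertex has degree exactly \<open>m\<close>, so its rising factorial starts at
  the constant \<open>m + \<delta>\<close>; the rest of the product is unchanged.\<close>

lemma urn_weight_new_vertex:
  assumes "valid_edges m R" "n \<ge> 1" "\<omega> \<in> space M"
  shows "urn_weight \<delta> R (Suc n) 0 (hist (Suc n) 0 \<omega>) =
    pochhammer (real m + \<delta>) (pending R (Suc n) 0 (Suc n)) * urn_weight \<delta> R n m (hist n m \<omega>)"
proof -
  have "pending R n m = pending R (Suc n) 0"
    using later_edges_full[OF assms(1)] by (simp add: pending_def fun_eq_iff)
  then show ?thesis
    using total_degree_hist_new[OF assms(2,3)] later_edges_full[OF assms(1), of n]
      hist_full[OF assms(2), of \<omega>]
    by (simp add: urn_weight_def)
qed

lemma total_degree_hist_root: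
  assumes "\<omega> \<in> space M"
  shows "total_degree (hist 2 0 \<omega>) 1 = m"
proof -
  have "hist 2 0 \<omega> = (\<lambda>l. (1, 2, l)) ` {1..m}"
    using E_2[OF _ assms] unfolding hist_def pa_partial_def by force
  moreover have "{(u, v, l) \<in> (\<lambda>l. (1::nat, 2::nat, l)) ` {1..m}. u = 1} = (\<lambda>l. (1, 2, l)) ` {1..m}"
    "{(u, v, l) \<in> (\<lambda>l. (1::nat, 2::nat, l)) ` {1..m}. v = 1} = {}"
    by auto
  moreover have "card ((\<lambda>l. (1::nat, 2::nat, l)) ` {1..m}) = m"
    by (subst card_image) (auto simp: inj_on_def)
  ultimately show ?thesis
    unfolding total_degree_def by (simp only: card.empty add_0 add_0_right)
qed

text \<open>In state \<open>(2, 0)\<close> both vertices have degree \<open>m\<close>, and validity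
  forces a prescribed edge of vertex 2 to end at vertex 1, where it lies surely. The initial weight
  is therefore deterministic.\<close>

lemma urn_weight_start:
  assumes R: "valid_edges m R" and \<omega>: "\<omega> \<in> space M"
  shows "urn_weight \<delta> R 2 0 (hist 2 0 \<omega>) = (\<Prod>i=1..2. pochhammer (real m + \<delta>) (pending R 2 0 i))"
proof -
  have "R - later_edges R 2 0 \<subseteq> hist 2 0 \<omega>"
  proof safe
    fix u v l assume *: "(u, v, l) \<in> R" "(u, v, l) \<notin> later_edges R 2 0"
    then have "u = 1" "v = 2" "l \<in> {1..m}"
      using R by (auto simp: later_edges_def valid_edges_def)
    then show "(u, v, l) \<in> hist 2 0 \<omega>"
      using E_2[OF _ \<omega>] unfolding hist_def pa_partial_def by auto
  qed
  moreover have "{1..2} = {1, 2 :: nat}" by auto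
  ultimately show ?thesis
    using total_degree_hist_root[OF \<omega>] total_degree_hist_new[of 1 \<omega>] \<omega>
    by (simp add: urn_weight_def numeral_2_eq_2)
qed

lemma expectation_urn_weight:
  assumes R: "valid_edges m R" and "N \<ge> 2"
  shows "expectation (\<lambda>\<omega>. urn_weight \<delta> R N 0 (hist N 0 \<omega>)) =
    (\<Prod>i=1..N. pochhammer (real m + \<delta>) (pending R 2 0 i)) *
    (\<Prod>n=2..<N. \<Prod>j<m. step_factor m \<delta> R n j)"
  using assms(2)
proof (induction N rule: dec_induct)
  case base
  have "expectation (\<lambda>\<omega>. urn_weight \<delta> R 2 0 (hist 2 0 \<omega>)) =
      expectation (\<lambda>\<omega>. \<Prod>i=1..2. pochhammer (real m + \<delta>) (pending R 2 0 i))"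
    using urn_weight_start[OF R] by (intro Bochner_Integration.integral_cong) auto
  then show ?case by (simp add: prob_space)
next
  case (step n)
  have *: "expectation (\<lambda>\<omega>. urn_weight \<delta> R n j (hist n j \<omega>)) =
      (\<Prod>i<j. step_factor m \<delta> R n i) * expectation (\<lambda>\<omega>. urn_weight \<delta> R n 0 (hist n 0 \<omega>))"
    if "j \<le> m" for j
    using that
  proof (induction j)
    case (Suc j)
    then show ?case
      using expectation_urn_weight_Suc[OF R, of n j] step.hyps by (simp add: mult_ac)
  qed simp
  have "expectation (\<lambda>\<omega>. urn_weight \<delta> R (Suc n) 0 (hist (Suc n) 0 \<omega>)) =
      expectation (\<lambda>\<omega>. pochhammer (real m + \<delta>) (pending R (Suc n) 0 (Suc n)) *
        urn_weight \<delta> R n m (hist n m \<omega>))"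
    using step.hyps by (intro Bochner_Integration.integral_cong urn_weight_new_vertex[OF R]) auto
  also have "\<dots> = pochhammer (real m + \<delta>) (pending R (Suc n) 0 (Suc n)) *
      expectation (\<lambda>\<omega>. urn_weight \<delta> R n m (hist n m \<omega>))"
    by simp
  finally show ?case
    using *[of m] step pending_self[OF R, of "Suc n"]
    by (simp add: prod.atLeast1_atMost_eq mult_ac atLeastLessThanSuc)
qed

text \<open>Once every prescribed slot is filled nothing is pending, all rising factorials are
  empty, and the urn weight has become the indicator of the event.\<close>

lemma prob_edges_eq:
  assumes R: "valid_edges m R" and "N \<ge> 2" and le: "fst ` snd ` R \<subseteq> {..N}"
  shows "prob {\<omega> \<in> space M. R \<subseteq> hist N 0 \<omega>} =
    (\<Prod>i=1..N. pochhammer (real m + \<delta>) (pending R 2 0 i)) *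
    (\<Prod>n=2..<N. \<Prod>j<m. step_factor m \<delta> R n j)"
proof -
  have "later_edges R N 0 = {}"
    using le unfolding later_edges_def by fastforce
  then have "urn_weight \<delta> R N 0 S = of_bool (R \<subseteq> S)" for S
    by (simp add: urn_weight_def pending_def)
  then have "expectation (\<lambda>\<omega>. urn_weight \<delta> R N 0 (hist N 0 \<omega>)) =
      expectation (indicator {\<omega> \<in> space M. R \<subseteq> hist N 0 \<omega>})"
    by (intro Bochner_Integration.integral_cong) (auto simp: indicator_def)
  also have "\<dots> = prob {\<omega> \<in> space M. R \<subseteq> hist N 0 \<omega>}"
    by (auto intro!: arg_cong[where f = prob])
  finally show ?thesis
    using expectation_urn_weight[OF assms(1,2)] by simp
qed

end

section \<open>Asymptotics of the edge probabilities\<close>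

text \<open>For \<open>x > 1\<close> the left side is negative. Validity for all nonnegative
  \<open>x\<close> allows the logarithmic estimates to start at \<open>n = 2\<close>, whatever the
  number of prescribed edges.\<close>

lemma ln_one_plus_lower:
  fixes x :: real
  assumes "x \<ge> 0"
  shows "x - x\<^sup>2 \<le> ln (1 + x)"
proof (cases "x \<le> 1")
  case True
  then show ?thesis using assms by (rule ln_one_plus_pos_lower_bound[rotated])
next
  case False
  then have "x * 1 \<le> x * x" by (intro mult_left_mono) auto
  then have "x - x\<^sup>2 \<le> 0" by (simp add: power2_eq_square)
  also have "0 \<le> ln (1 + x)" using assms by simp
  finally show ?thesis .
qed

text \<open>Telescoping with \<open>1 / n\<^sup>2 \<le> 1 / (n - 1) - 1 / n\<close>. A bound that is
  uniform in both ends is what makes all error terms below bounded.\<close>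

lemma sum_inverse_squares_le:
  assumes "a \<ge> 2"
  shows "(\<Sum>n=a..<b. 1 / (real n)\<^sup>2) \<le> 1"
proof -
  have "(\<Sum>n=a..<b. 1 / (real n)\<^sup>2) \<le> 1 - 1 / (real b - 1)" if "a \<le> b"
    using that
  proof (induction b rule: dec_induct)
    case base
    then show ?case using assms by simp
  next
    case (step n)
    have "1 / (real n)\<^sup>2 \<le> 1 / (real n - 1) - 1 / real n"
      using step assms by (simp add: field_simps power2_eq_square)
    with step show ?case by simp
  qed
  moreover have "1 / (real b - 1) \<ge> 0" if "a \<le> b"
    using that assms by simp
  moreover have "(\<Sum>n=a..<b. 1 / (real n)\<^sup>2) = 0" if "b < a"
    using that by simp
  ultimately show ?thesis
    by (smt (verit) not_less)
qed

context pa_parameters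
begin

text \<open>It has two roles: the attachment weight of a newborn vertex, and the constant in the
  lower bound \<open>n * \<epsilon>\<close> for the normalization. Both need
  \<open>\<delta> > - m\<close>.\<close>

definition \<epsilon> :: real where "\<epsilon> = real m + \<delta>"

definition \<kappa> :: real where "\<kappa> = real m / (2 * real m + \<delta>)"

lemma \<epsilon>_pos: "\<epsilon> > 0"
  using \<delta>_gt by (simp add: \<epsilon>_def)

lemma \<epsilon>_le: "\<epsilon> \<le> 2 * real m + \<delta>"
  by (simp add: \<epsilon>_def)

lemma \<kappa>_bounds: "0 < \<kappa>" "\<kappa> \<le> real m / \<epsilon>"
  using \<epsilon>_pos \<epsilon>_le m_pos by (auto simp: \<kappa>_def intro!: divide_pos_pos divide_left_mono)

lemma attach_norm_ge: "n \<ge> 2 \<Longrightarrow> real n * \<epsilon> \<le> attach_norm m \<delta> n j"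
proof -
  assume "n \<ge> 2"
  have "attach_norm m \<delta> n j = real n * \<epsilon> + real m * (real n - 2) + real j"
    by (simp add: attach_norm_def \<epsilon>_def algebra_simps)
  moreover have "real m * (real n - 2) \<ge> 0" using \<open>n \<ge> 2\<close> by simp
  ultimately show ?thesis by simp
qed

lemma attach_norm_pos: "n \<ge> 2 \<Longrightarrow> attach_norm m \<delta> n j > 0"
  using attach_norm_ge[of n j] \<epsilon>_pos by (smt (verit) mult_pos_pos of_nat_0_less_iff pos2 order_less_le_trans)

lemma attach_norm_le:
  assumes "n \<ge> 2" "j < m"
  shows "attach_norm m \<delta> n j \<le> real n * (3 * real m + \<bar>\<delta>\<bar>)"
proof -
  have "real n * \<delta> \<le> real n * \<bar>\<delta>\<bar>" by (intro mult_left_mono) auto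
  moreover have "real j \<le> real n * real m"
    using assms mult_mono[of 1 "real n" "real j" "real m"] by simp
  ultimately show ?thesis by (simp add: attach_norm_def algebra_simps)
qed

lemma inverse_attach_norm_bounds:
  assumes "n \<ge> 2"
  shows "0 \<le> 1 / attach_norm m \<delta> n j" "1 / attach_norm m \<delta> n j \<le> (1 / \<epsilon>) * (1 / real n)"
proof -
  show "0 \<le> 1 / attach_norm m \<delta> n j" using attach_norm_pos[OF assms, of j] by simp
  have "1 / attach_norm m \<delta> n j \<le> 1 / (real n * \<epsilon>)"
    using attach_norm_ge[OF assms, of j] attach_norm_pos[OF assms, of j] \<epsilon>_pos assms
    by (intro divide_left_mono) auto
  then show "1 / attach_norm m \<delta> n j \<le> (1 / \<epsilon>) * (1 / real n)" by (simp add: mult.commute)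
qed

definition vertex_rate :: "nat \<Rightarrow> real" where
  "vertex_rate n = (\<Sum>j<m. 1 / attach_norm m \<delta> n j)"

lemma vertex_rate_bounds:
  assumes "n \<ge> 2"
  shows "0 \<le> vertex_rate n" "vertex_rate n \<le> real m / \<epsilon>"
proof -
  show "0 \<le> vertex_rate n"
    unfolding vertex_rate_def using inverse_attach_norm_bounds(1)[OF assms] by (intro sum_nonneg)
  have "1 / attach_norm m \<delta> n j \<le> 1 / \<epsilon>" for j
  proof -
    have "(1 / \<epsilon>) * (1 / real n) \<le> (1 / \<epsilon>) * 1"
      using assms \<epsilon>_pos by (intro mult_left_mono) auto
    then show ?thesis using inverse_attach_norm_bounds(2)[OF assms, of j] by simp
  qed
  then have "vertex_rate n \<le> (\<Sum>j<m. 1 / \<epsilon>)"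
    unfolding vertex_rate_def by (intro sum_mono)
  then show "vertex_rate n \<le> real m / \<epsilon>" by simp
qed

text \<open>The first term pays for replacing the normalization by
  \<open>(2 * m + \<delta>) * n\<close>, the second for replacing \<open>1 / n\<close> by an
  increment of the logarithm.\<close>

definition rate_error :: real where "rate_error = 2 * (real m)\<^sup>2 / \<epsilon>\<^sup>2 + \<kappa>"

lemma rate_error_nonneg: "rate_error \<ge> 0"
  using \<kappa>_bounds by (simp add: rate_error_def)

text \<open>The normalization differs from its leading term by \<open>2 * m - j\<close>, which is
  bounded in \<open>n\<close>, so each reciprocal is off by O(1 / n^2). The logarithmic form of the
  main term is chosen because it telescopes.\<close>

lemma vertex_rate_approx:
  assumes n: "n \<ge> 2"
  shows "\<bar>vertex_rate n - \<kappa> * (ln (real (Suc n)) - ln (real n))\<bar> \<le> rate_error * (1 / (real n)\<^sup>2)"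
proof -
  define d where "d = 2 * real m + \<delta>"
  have d: "d > 0" "\<epsilon> \<le> d" using \<epsilon>_pos \<epsilon>_le by (auto simp: d_def)
  have each: "\<bar>1 / attach_norm m \<delta> n j - 1 / (d * real n)\<bar> \<le> 2 * real m / \<epsilon>\<^sup>2 * (1 / (real n)\<^sup>2)"
    if "j < m" for j
  proof -
    note z = attach_norm_pos[OF n, of j] attach_norm_ge[OF n, of j]
    have num: "d * real n - attach_norm m \<delta> n j = 2 * real m - real j"
      by (simp add: d_def attach_norm_def algebra_simps)
    have "\<bar>1 / attach_norm m \<delta> n j - 1 / (d * real n)\<bar> =
        \<bar>(d * real n - attach_norm m \<delta> n j) / (attach_norm m \<delta> n j * (d * real n))\<bar>"
      using z d n by (simp add: field_simps)
    also have "\<dots> = (2 * real m - real j) / (attach_norm m \<delta> n j * (d * real n))"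
      unfolding num using z d n that by (intro abs_of_nonneg divide_nonneg_nonneg) auto
    also have "\<dots> \<le> 2 * real m / ((real n * \<epsilon>) * (\<epsilon> * real n))"
      using z d n that \<epsilon>_pos by (intro frac_le mult_mono mult_right_mono) auto
    also have "\<dots> = 2 * real m / \<epsilon>\<^sup>2 * (1 / (real n)\<^sup>2)"
      by (simp add: power2_eq_square mult_ac)
    finally show ?thesis .
  qed
  have "\<kappa> / real n = (\<Sum>j<m. 1 / (d * real n))"
    by (simp add: \<kappa>_def d_def)
  then have "\<bar>vertex_rate n - \<kappa> / real n\<bar> \<le> (\<Sum>j<m. \<bar>1 / attach_norm m \<delta> n j - 1 / (d * real n)\<bar>)"
    unfolding vertex_rate_def by (simp only: sum_subtractf[symmetric] sum_abs)
  also have "\<dots> \<le> (\<Sum>j<m. 2 * real m / \<epsilon>\<^sup>2 * (1 / (real n)\<^sup>2))"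
    using each by (intro sum_mono) auto
  also have "\<dots> = 2 * (real m)\<^sup>2 / \<epsilon>\<^sup>2 * (1 / (real n)\<^sup>2)"
    by (simp add: power2_eq_square)
  finally have 1: "\<bar>vertex_rate n - \<kappa> / real n\<bar> \<le> 2 * (real m)\<^sup>2 / \<epsilon>\<^sup>2 * (1 / (real n)\<^sup>2)" .
  have "1 + 1 / real n = real (Suc n) / real n"
    using n by (simp add: field_simps)
  then have "ln (real (Suc n)) - ln (real n) = ln (1 + 1 / real n)"
    using n by (simp only: ln_div) simp
  moreover have "ln (1 + 1 / real n) \<le> 1 / real n"
    by (intro ln_add_one_self_le_self) auto
  moreover have "1 / real n - (1 / real n)\<^sup>2 \<le> ln (1 + 1 / real n)"
    by (intro ln_one_plus_lower) auto
  ultimately have "\<bar>1 / real n - (ln (real (Suc n)) - ln (real n))\<bar> \<le> 1 / (real n)\<^sup>2"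
    by (simp add: power_one_over)
  then have "\<bar>\<kappa>\<bar> * \<bar>1 / real n - (ln (real (Suc n)) - ln (real n))\<bar> \<le> \<kappa> * (1 / (real n)\<^sup>2)"
    using \<kappa>_bounds by (intro mult_mono) auto
  then have "\<bar>\<kappa> / real n - \<kappa> * (ln (real (Suc n)) - ln (real n))\<bar> \<le> \<kappa> * (1 / (real n)\<^sup>2)"
    by (simp only: abs_mult[symmetric]) (simp add: right_diff_distrib)
  with 1 show ?thesis
    unfolding rate_error_def distrib_right by linarith
qed

lemma sum_vertex_rate_approx:
  assumes "2 \<le> a" "a \<le> b"
  shows "\<bar>(\<Sum>n=a..<b. vertex_rate n) - \<kappa> * (ln (real b) - ln (real a))\<bar> \<le> rate_error"
proof -
  have "(\<Sum>n=a..<b. ln (real (Suc n)) - ln (real n)) = ln (real b) - ln (real a)"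
    using assms sum_Suc_diff'[of a b "\<lambda>n. ln (real n)"] by simp
  then have "\<bar>(\<Sum>n=a..<b. vertex_rate n) - \<kappa> * (ln (real b) - ln (real a))\<bar> =
      \<bar>\<Sum>n=a..<b. vertex_rate n - \<kappa> * (ln (real (Suc n)) - ln (real n))\<bar>"
    by (simp only: sum_subtractf sum_distrib_left[symmetric])
  also have "\<dots> \<le> (\<Sum>n=a..<b. \<bar>vertex_rate n - \<kappa> * (ln (real (Suc n)) - ln (real n))\<bar>)"
    by (rule sum_abs)
  also have "\<dots> \<le> (\<Sum>n=a..<b. rate_error * (1 / (real n)\<^sup>2))"
    using assms by (intro sum_mono vertex_rate_approx) auto
  also have "\<dots> \<le> rate_error * 1"
    unfolding sum_distrib_left[symmetric]
    using rate_error_nonneg assms by (intro mult_left_mono sum_inverse_squares_le)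
  finally show ?thesis by simp
qed

text \<open>The share of one prescribed edge in the sum of pending counts over normalizations: it
  contributes at the steps where \<open>u\<close> exists and the slot \<open>(v, l)\<close> is not
  yet filled.\<close>

definition edge_rate :: "nat \<Rightarrow> nat \<times> nat \<times> nat \<Rightarrow> real" where
  "edge_rate N = (\<lambda>(u, v, l). \<Sum>n=2..<N. \<Sum>j<m.
     if u \<le> n \<and> (v > Suc n \<or> v = Suc n \<and> l > j) then 1 / attach_norm m \<delta> n j else 0)"

text \<open>The edge waits roughly from time \<open>u\<close> to time \<open>v\<close>, which
  accounts for the difference of logarithms. The extra \<open>real m / \<epsilon>\<close> bounds the
  partial contribution of vertex \<open>v\<close>; \<open>2 * \<kappa>\<close> pays for rounding the
  two ends.\<close>

lemma edge_rate_approx: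
  assumes uv: "1 \<le> u" "u < v" "v \<le> N"
  shows "\<bar>edge_rate N (u, v, l) - \<kappa> * (ln (real v) - ln (real u))\<bar> \<le>
    rate_error + real m / \<epsilon> + 2 * \<kappa>"
proof -
  have ln2: "ln 2 \<le> (1 :: real)"
    using ln_add_one_self_le_self[of 1] by simp
  show ?thesis
  proof (cases "v = 2")
    case True
    then have "u = 1" using uv by simp
    have "edge_rate N (u, v, l) = 0"
      using True by (auto simp: edge_rate_def intro!: sum.neutral)
    moreover have "\<kappa> * ln 2 \<le> \<kappa> * 1"
      using ln2 \<kappa>_bounds by (intro mult_left_mono) auto
    moreover have "0 \<le> \<kappa> * ln 2"
      using \<kappa>_bounds by simp
    moreover have "0 \<le> real m / \<epsilon>"
      using \<epsilon>_pos by simp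
    moreover have "\<kappa> * (ln (real v) - ln (real u)) = \<kappa> * ln 2"
      using True \<open>u = 1\<close> by simp
    ultimately show ?thesis
      using rate_error_nonneg \<kappa>_bounds by linarith
  next
    case False
    \<comment> \<open>Steps start at \<open>n = 2\<close>, so the waiting time cannot start at
      \<open>u = 1\<close>. As \<open>a \<le> 2 * u\<close>, this shifts the logarithm by at most
      \<open>ln 2 \<le> 1\<close>; the same holds for \<open>v - 1\<close> in place of
      \<open>v\<close>.\<close>
    define a where "a = max 2 u"
    have a: "2 \<le> a" "a \<le> v - 1" "u \<le> a" "a \<le> 2 * u" and v: "3 \<le> v"
      using uv False by (auto simp: a_def)
    let ?f = "\<lambda>n. \<Sum>j<m. if u \<le> n \<and> (v > Suc n \<or> v = Suc n \<and> l > j) then 1 / attach_norm m \<delta> n j else 0"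
    have "edge_rate N (u, v, l) = (\<Sum>n=2..<N. ?f n)"
      by (simp add: edge_rate_def)
    also have "\<dots> = (\<Sum>n=a..<v. ?f n)"
      using uv a by (intro sum.mono_neutral_right) (auto simp: a_def intro!: sum.neutral)
    \<comment> \<open>Before the turn of vertex \<open>v\<close> all \<open>m\<close> steps of a
      vertex count. In the block \<open>n = v - 1\<close>, where \<open>v\<close> attaches its own
      edges, only the steps \<open>j < l\<close> do.\<close>
    also have "\<dots> = (\<Sum>n=a..<v - 1. ?f n) + ?f (v - 1)"
    proof -
      have "{a..<v} = insert (v - 1) {a..<v - 1}" using a v by auto
      then show ?thesis by (simp del: One_nat_def)
    qed
    also have "(\<Sum>n=a..<v - 1. ?f n) = (\<Sum>n=a..<v - 1. vertex_rate n)"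
      using a unfolding vertex_rate_def by (intro sum.cong) auto
    finally have eq: "edge_rate N (u, v, l) = (\<Sum>n=a..<v - 1. vertex_rate n) + ?f (v - 1)" .
    have "?f (v - 1) \<le> vertex_rate (v - 1)"
      unfolding vertex_rate_def using v inverse_attach_norm_bounds(1)[of "v - 1"]
      by (intro sum_mono) auto
    then have last: "?f (v - 1) \<le> real m / \<epsilon>"
      using vertex_rate_bounds(2)[of "v - 1"] v by linarith
    have last0: "0 \<le> ?f (v - 1)"
      using v inverse_attach_norm_bounds(1)[of "v - 1"] by (intro sum_nonneg) auto
    have la: "ln (real u) \<le> ln (real a)" "ln (real a) \<le> ln 2 + ln (real u)"
    proof -
      show "ln (real u) \<le> ln (real a)" using a uv by simp
      have "ln (real a) \<le> ln (2 * real u)" using a by (subst ln_le_cancel_iff) auto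
      then show "ln (real a) \<le> ln 2 + ln (real u)" using uv by (simp add: ln_mult)
    qed
    have lv: "ln (real (v - 1)) \<le> ln (real v)" "ln (real v) \<le> ln 2 + ln (real (v - 1))"
    proof -
      show "ln (real (v - 1)) \<le> ln (real v)" using v by simp
      have "ln (real v) \<le> ln (2 * real (v - 1))" using v by (subst ln_le_cancel_iff) auto
      moreover have "ln (2 * real (v - 1)) = ln 2 + ln (real (v - 1))"
        using v by (intro ln_mult_pos) auto
      ultimately show "ln (real v) \<le> ln 2 + ln (real (v - 1))" by linarith
    qed
    have "\<bar>(ln (real (v - 1)) - ln (real a)) - (ln (real v) - ln (real u))\<bar> \<le> 2"
      using la lv ln2 by linarith
    then have "\<kappa> * \<bar>(ln (real (v - 1)) - ln (real a)) - (ln (real v) - ln (real u))\<bar> \<le> \<kappa> * 2"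
      using \<kappa>_bounds by (intro mult_left_mono) auto
    then have "\<bar>\<kappa> * (ln (real (v - 1)) - ln (real a)) - \<kappa> * (ln (real v) - ln (real u))\<bar> \<le> 2 * \<kappa>"
      using \<kappa>_bounds unfolding right_diff_distrib[symmetric] abs_mult by simp
    then show ?thesis
      using sum_vertex_rate_approx[OF a(1,2)] eq last last0 by linarith
  qed
qed

end

section \<open>From single edges to products over all steps, uniformly in the edge set\<close>

definition later_count :: "(nat \<times> nat \<times> nat) set \<Rightarrow> nat \<Rightarrow> nat \<Rightarrow> nat" where
  "later_count R n j = (\<Sum>i=1..n. pending R n j i)"

text \<open>The count is additive over the prescribed edges, so its sum over all steps can be
  exchanged with the sum over edges.\<close>

lemma later_count_eq:
  assumes "valid_edges m R"
  shows "real (later_count R n j) =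
    (\<Sum>(u, v, l)\<in>R. of_bool (u \<le> n \<and> (v > Suc n \<or> v = Suc n \<and> l > j)))"
proof -
  have fin: "finite R" using assms by (simp add: valid_edges_def)
  have "real (pending R n j i) = (\<Sum>e\<in>R. of_bool (e \<in> later_edges R n j \<and> fst e = i))" for i
  proof -
    have "(\<Sum>e\<in>R. of_bool (e \<in> later_edges R n j \<and> fst e = i)) =
        real (card (R \<inter> {e. e \<in> later_edges R n j \<and> fst e = i}))"
      using fin by (simp add: sum_of_bool_eq)
    moreover have "R \<inter> {e. e \<in> later_edges R n j \<and> fst e = i} = {e \<in> later_edges R n j. fst e = i}"
      unfolding later_edges_def by auto
    ultimately show ?thesis by (simp add: pending_def)
  qed
  then have "real (later_count R n j) =
      (\<Sum>i=1..n. \<Sum>e\<in>R. of_bool (e \<in> later_edges R n j \<and> fst e = i))"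
    by (simp add: later_count_def)
  also have "\<dots> = (\<Sum>e\<in>R. \<Sum>i=1..n. of_bool (e \<in> later_edges R n j \<and> fst e = i))"
    by (rule sum.swap)
  also have "\<dots> = (\<Sum>e\<in>R. of_bool (fst e \<le> n \<and> e \<in> later_edges R n j))"
  proof (intro sum.cong refl)
    fix e assume "e \<in> R"
    then have "1 \<le> fst e" using assms by (auto simp: valid_edges_def)
    moreover have "(\<Sum>i=1..n. of_bool (e \<in> later_edges R n j \<and> fst e = i)) =
        (\<Sum>i=1..n. if i = fst e then of_bool (e \<in> later_edges R n j) else 0 :: real)"
      by (intro sum.cong) auto
    ultimately show "(\<Sum>i=1..n. of_bool (e \<in> later_edges R n j \<and> fst e = i)) =
        (of_bool (fst e \<le> n \<and> e \<in> later_edges R n j) :: real)"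
      by simp
  qed
  also have "\<dots> = (\<Sum>(u, v, l)\<in>R. of_bool (u \<le> n \<and> (v > Suc n \<or> v = Suc n \<and> l > j)))"
    by (intro sum.cong) (auto simp: later_edges_def)
  finally show ?thesis .
qed

lemma later_count_le:
  assumes "valid_edges m R"
  shows "later_count R n j \<le> card R"
proof -
  have "real (later_count R n j) \<le> (\<Sum>e\<in>R. 1)"
    unfolding later_count_eq[OF assms] by (intro sum_mono) auto
  then show ?thesis by simp
qed

lemma sum_pending_le:
  assumes "valid_edges m R"
  shows "(\<Sum>i=1..N. pending R 2 0 i) \<le> card R"
proof -
  have fin: "finite R" using assms by (simp add: valid_edges_def)
  have "(\<Sum>i=1..N. pending R 2 0 i) = card (\<Union>i\<in>{1..N}. {e \<in> later_edges R 2 0. fst e = i})"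
    unfolding pending_def using finite_later_edges[OF fin]
    by (subst card_UN_disjoint) auto
  also have "\<dots> \<le> card R"
    using fin by (intro card_mono) (auto simp: later_edges_def)
  finally show ?thesis .
qed

context pa_parameters
begin

lemma pochhammer_between:
  assumes "p \<le> K"
  shows "min 1 \<epsilon> ^ p \<le> pochhammer \<epsilon> p" "pochhammer \<epsilon> p \<le> (1 + \<epsilon> + real K) ^ p"
proof -
  have "pochhammer \<epsilon> p = (\<Prod>i=0..<p. \<epsilon> + of_nat i)"
    by (simp add: pochhammer_prod)
  moreover have "(\<Prod>i=0..<p. min 1 \<epsilon>) \<le> (\<Prod>i=0..<p. \<epsilon> + of_nat i)"
    using \<epsilon>_pos by (intro prod_mono) auto
  moreover have "(\<Prod>i=0..<p. \<epsilon> + of_nat i) \<le> (\<Prod>i=0..<p. 1 + \<epsilon> + real K)"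
    using assms \<epsilon>_pos by (intro prod_mono) auto
  ultimately show "min 1 \<epsilon> ^ p \<le> pochhammer \<epsilon> p" "pochhammer \<epsilon> p \<le> (1 + \<epsilon> + real K) ^ p"
    by simp_all
qed

text \<open>The product has \<open>N\<close> factors, but the lengths of the rising factorials add
  up to at most \<open>K\<close>, so the bounds do not involve \<open>N\<close>. The minimum with 1
  makes powers decrease in the exponent, so that \<open>K\<close> may replace the actual total
  length.\<close>

lemma prod_pochhammer_bounds:
  assumes "valid_edges m R" "card R \<le> K"
  shows "min 1 \<epsilon> ^ K \<le> (\<Prod>i=1..N. pochhammer \<epsilon> (pending R 2 0 i))"
    "(\<Prod>i=1..N. pochhammer \<epsilon> (pending R 2 0 i)) \<le> (1 + \<epsilon> + real K) ^ K"
proof -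
  let ?p = "pending R 2 0"
  have sum_le: "(\<Sum>i=1..N. ?p i) \<le> K"
    using sum_pending_le[OF assms(1), of N] assms(2) by linarith
  have p_le: "?p i \<le> K" if "i \<in> {1..N}" for i
    using member_le_sum[of i "{1..N}" ?p] that sum_le by simp
  have "min 1 \<epsilon> ^ K \<le> min 1 \<epsilon> ^ (\<Sum>i=1..N. ?p i)"
    using sum_le \<epsilon>_pos by (intro power_decreasing) auto
  also have "\<dots> = (\<Prod>i=1..N. min 1 \<epsilon> ^ ?p i)"
    by (simp add: power_sum)
  also have "\<dots> \<le> (\<Prod>i=1..N. pochhammer \<epsilon> (?p i))"
    using p_le pochhammer_between(1) \<epsilon>_pos by (intro prod_mono) auto
  finally show "min 1 \<epsilon> ^ K \<le> (\<Prod>i=1..N. pochhammer \<epsilon> (?p i))" .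
  have "(\<Prod>i=1..N. pochhammer \<epsilon> (?p i)) \<le> (\<Prod>i=1..N. (1 + \<epsilon> + real K) ^ ?p i)"
    using p_le pochhammer_between(2) \<epsilon>_pos pochhammer_pos[OF \<epsilon>_pos]
    by (intro prod_mono) (auto intro: less_imp_le)
  also have "\<dots> = (1 + \<epsilon> + real K) ^ (\<Sum>i=1..N. ?p i)"
    by (simp add: power_sum)
  also have "\<dots> \<le> (1 + \<epsilon> + real K) ^ K"
    using sum_le \<epsilon>_pos by (intro power_increasing) auto
  finally show "(\<Prod>i=1..N. pochhammer \<epsilon> (?p i)) \<le> (1 + \<epsilon> + real K) ^ K" .
qed

lemma sum_later_rate:
  assumes "valid_edges m R"
  shows "(\<Sum>n=2..<N. \<Sum>j<m. real (later_count R n j) / attach_norm m \<delta> n j) =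
    (\<Sum>e\<in>R. edge_rate N e)"
proof -
  have "(\<Sum>n=2..<N. \<Sum>j<m. real (later_count R n j) / attach_norm m \<delta> n j) =
    (\<Sum>n=2..<N. \<Sum>j<m. \<Sum>(u, v, l)\<in>R. if u \<le> n \<and> (v > Suc n \<or> v = Suc n \<and> l > j)
       then 1 / attach_norm m \<delta> n j else 0)"
    unfolding later_count_eq[OF assms] sum_divide_distrib
    by (intro sum.cong refl) auto
  also have "\<dots> = (\<Sum>(u, v, l)\<in>R. \<Sum>n=2..<N. \<Sum>j<m.
      if u \<le> n \<and> (v > Suc n \<or> v = Suc n \<and> l > j) then 1 / attach_norm m \<delta> n j else 0)"
    by (simp only: sum.swap[where B = R] split_def)
  finally show ?thesis
    by (simp add: edge_rate_def split_def)
qed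

text \<open>From \<open>x - x\<^sup>2 \<le> ln (1 + x) \<le> x\<close>. Since \<open>x\<close> is at
  most \<open>(K / \<epsilon>) / n\<close> and there are \<open>m\<close> steps per vertex, the
  squares sum to at most \<open>m * (K / \<epsilon>)\<^sup>2\<close>.\<close>

lemma sum_ln_growth_bounds:
  assumes R: "valid_edges m R" and K: "card R \<le> K"
  defines "x \<equiv> \<lambda>n j. real (later_count R n j) / attach_norm m \<delta> n j"
  shows "(\<Sum>n=2..<N. \<Sum>j<m. ln (1 + x n j)) \<le> (\<Sum>e\<in>R. edge_rate N e)"
    "(\<Sum>e\<in>R. edge_rate N e) - real m * (real K / \<epsilon>)\<^sup>2 \<le> (\<Sum>n=2..<N. \<Sum>j<m. ln (1 + x n j))"
proof -
  have x: "0 \<le> x n j" "x n j \<le> real K / \<epsilon> * (1 / real n)" if "n \<ge> 2" for n j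
  proof -
    show "0 \<le> x n j" using attach_norm_pos[OF that, of j] by (simp add: x_def)
    have "x n j = real (later_count R n j) * (1 / attach_norm m \<delta> n j)" by (simp add: x_def)
    also have "\<dots> \<le> real K * ((1 / \<epsilon>) * (1 / real n))"
      using inverse_attach_norm_bounds[OF that, of j] later_count_le[OF R, of n j] K
      by (intro mult_mono) auto
    finally show "x n j \<le> real K / \<epsilon> * (1 / real n)" by simp
  qed
  have sum_x: "(\<Sum>n=2..<N. \<Sum>j<m. x n j) = (\<Sum>e\<in>R. edge_rate N e)"
    unfolding x_def by (rule sum_later_rate[OF R])
  show "(\<Sum>n=2..<N. \<Sum>j<m. ln (1 + x n j)) \<le> (\<Sum>e\<in>R. edge_rate N e)"
    unfolding sum_x[symmetric] using x(1) by (intro sum_mono ln_add_one_self_le_self) auto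
  have "(\<Sum>n=2..<N. \<Sum>j<m. (x n j)\<^sup>2) \<le> (\<Sum>n=2..<N. \<Sum>j<m. (real K / \<epsilon>)\<^sup>2 * (1 / (real n)\<^sup>2))"
  proof (intro sum_mono)
    fix n j assume "n \<in> {2..<N}"
    then have "(x n j)\<^sup>2 \<le> (real K / \<epsilon> * (1 / real n))\<^sup>2"
      using x[of n j] by (intro power_mono) auto
    then show "(x n j)\<^sup>2 \<le> (real K / \<epsilon>)\<^sup>2 * (1 / (real n)\<^sup>2)"
      by (simp add: power_mult_distrib power_divide)
  qed
  also have "\<dots> = real m * (real K / \<epsilon>)\<^sup>2 * (\<Sum>n=2..<N. 1 / (real n)\<^sup>2)"
    by (simp add: sum_distrib_left mult_ac)
  also have "\<dots> \<le> real m * (real K / \<epsilon>)\<^sup>2 * 1"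
    by (intro mult_left_mono sum_inverse_squares_le) auto
  finally have sq: "(\<Sum>n=2..<N. \<Sum>j<m. (x n j)\<^sup>2) \<le> real m * (real K / \<epsilon>)\<^sup>2" by simp
  have "(\<Sum>n=2..<N. \<Sum>j<m. x n j - (x n j)\<^sup>2) \<le> (\<Sum>n=2..<N. \<Sum>j<m. ln (1 + x n j))"
    using x(1) by (intro sum_mono ln_one_plus_lower) auto
  then show "(\<Sum>e\<in>R. edge_rate N e) - real m * (real K / \<epsilon>)\<^sup>2 \<le> (\<Sum>n=2..<N. \<Sum>j<m. ln (1 + x n j))"
    using sq sum_x by (simp add: sum_subtractf)
qed

lemma sum_edge_rate_approx:
  assumes R: "valid_edges m R" "card R \<le> K" and le: "fst ` snd ` R \<subseteq> {..N}"
  shows "\<bar>(\<Sum>e\<in>R. edge_rate N e) - (\<Sum>(u, v, l)\<in>R. \<kappa> * (ln (real v) - ln (real u)))\<bar> \<le>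
    real K * (rate_error + real m / \<epsilon> + 2 * \<kappa>)"
proof -
  let ?c = "rate_error + real m / \<epsilon> + 2 * \<kappa>"
  have c: "?c \<ge> 0" using rate_error_nonneg \<epsilon>_pos \<kappa>_bounds by simp
  have "\<bar>(\<Sum>e\<in>R. edge_rate N e) - (\<Sum>(u, v, l)\<in>R. \<kappa> * (ln (real v) - ln (real u)))\<bar> \<le>
      (\<Sum>e\<in>R. \<bar>edge_rate N e - (case e of (u, v, l) \<Rightarrow> \<kappa> * (ln (real v) - ln (real u)))\<bar>)"
    unfolding sum_subtractf[symmetric] by (rule sum_abs)
  also have "\<dots> \<le> (\<Sum>e\<in>R. ?c)"
  proof (intro sum_mono)
    fix e assume e: "e \<in> R"
    obtain u v l where [simp]: "e = (u, v, l)" by (cases e)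
    show "\<bar>edge_rate N e - (case e of (u, v, l) \<Rightarrow> \<kappa> * (ln (real v) - ln (real u)))\<bar> \<le> ?c"
      using e R(1) le by (auto intro!: edge_rate_approx simp: valid_edges_def image_subset_iff split_paired_all)
  qed
  also have "\<dots> \<le> real K * ?c"
    using R c by (simp add: mult_right_mono)
  finally show ?thesis .
qed

text \<open>The error of \<open>edge_rate_approx\<close> for each of at most \<open>K\<close> edges,
  plus the loss in passing from \<open>ln (1 + x)\<close> to \<open>x\<close>.\<close>

definition growth_error :: "nat \<Rightarrow> real" where
  "growth_error K = real K * (rate_error + real m / \<epsilon> + 2 * \<kappa>) + real m * (real K / \<epsilon>)\<^sup>2"

lemma prod_growth_bounds:
  assumes R: "valid_edges m R" "card R \<le> K" and le: "fst ` snd ` R \<subseteq> {..N}"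
  defines "G \<equiv> (\<Prod>n=2..<N. \<Prod>j<m. 1 + real (later_count R n j) / attach_norm m \<delta> n j)"
  defines "W \<equiv> (\<Prod>(u, v, l)\<in>R. real u powr - \<kappa> * real v powr \<kappa>)"
  shows "exp (- growth_error K) * W \<le> G" "G \<le> exp (growth_error K) * W"
proof -
  have fin: "finite R" using R by (simp add: valid_edges_def)
  have "W = (\<Prod>(u, v, l)\<in>R. exp (\<kappa> * (ln (real v) - ln (real u))))"
    unfolding W_def
  proof (intro prod.cong refl)
    fix e assume "e \<in> R"
    then show "(case e of (u, v, l) \<Rightarrow> real u powr - \<kappa> * real v powr \<kappa>) =
        (case e of (u, v, l) \<Rightarrow> exp (\<kappa> * (ln (real v) - ln (real u))))"
      using R by (auto simp: valid_edges_def powr_def exp_add[symmetric] algebra_simps)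
  qed
  then have W: "W = exp (\<Sum>(u, v, l)\<in>R. \<kappa> * (ln (real v) - ln (real u)))"
    using fin by (simp add: exp_sum split_def)
  have "1 + real (later_count R n j) / attach_norm m \<delta> n j =
      exp (ln (1 + real (later_count R n j) / attach_norm m \<delta> n j))" if "n \<ge> 2" for n j
    using attach_norm_pos[OF that, of j] by (simp add: add_pos_nonneg)
  then have "G = (\<Prod>n=2..<N. \<Prod>j<m. exp (ln (1 + real (later_count R n j) / attach_norm m \<delta> n j)))"
    unfolding G_def by (intro prod.cong) auto
  then have G: "G = exp (\<Sum>n=2..<N. \<Sum>j<m. ln (1 + real (later_count R n j) / attach_norm m \<delta> n j))"
    by (simp add: exp_sum)
  have nn: "0 \<le> real m * (real K / \<epsilon>)\<^sup>2" by simp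
  show "exp (- growth_error K) * W \<le> G" "G \<le> exp (growth_error K) * W"
    unfolding G W exp_add[symmetric] exp_le_cancel_iff
    using sum_ln_growth_bounds[OF R, of N] sum_edge_rate_approx[OF R le] nn
    by (simp_all only: growth_error_def)
qed

text \<open>The edges of vertex 2 are deterministic, so they carry the factor 1.\<close>

definition required_factor :: "(nat \<times> nat \<times> nat) set \<Rightarrow> nat \<times> nat \<Rightarrow> real" where
  "required_factor R = (\<lambda>(v, l). if v \<ge> 3 then
     1 / (attach_norm m \<delta> (v - 1) (l - 1) + real (later_count R (v - 1) (l - 1))) else 1)"

text \<open>With normalization z and pending count q,
  \<open>1 / z = (1 + q / z) * (1 / (z + q))\<close>. Hence the growth factor can run over all
  steps, prescribed or not, and each prescribed edge leaves just \<open>1 / (z + q)\<close>.\<close>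

lemma prod_step_factor_split:
  assumes R: "valid_edges m R" and le: "fst ` snd ` R \<subseteq> {..N}"
  shows "(\<Prod>n=2..<N. \<Prod>j<m. step_factor m \<delta> R n j) =
    (\<Prod>n=2..<N. \<Prod>j<m. 1 + real (later_count R n j) / attach_norm m \<delta> n j) *
    (\<Prod>e\<in>R. required_factor R (snd e))"
proof -
  have fin: "finite R" using R by (simp add: valid_edges_def)
  define h where "h = (\<lambda>(n, j). 1 / (attach_norm m \<delta> n j + real (later_count R n j)))"
  define req where "req = {p \<in> {2..<N} \<times> {..<m}. (Suc (fst p), Suc (snd p)) \<in> snd ` R}"
  have "step_factor m \<delta> R n j = (1 + real (later_count R n j) / attach_norm m \<delta> n j) *
      (if (Suc n, Suc j) \<in> snd ` R then h (n, j) else 1)" if "n \<ge> 2" for n j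
  proof -
    define z where "z = attach_norm m \<delta> n j"
    define q where "q = real (later_count R n j)"
    have "z > 0" "q \<ge> 0" using attach_norm_pos[OF that, of j] by (auto simp: z_def q_def)
    then have "1 + q / z = (z + q) / z" "z + q \<noteq> 0" by (auto simp: add_divide_distrib)
    then have "1 / z = (1 + q / z) * (1 / (z + q))" by simp
    then show ?thesis
      unfolding step_factor_def later_count_def[symmetric] h_def
      by (simp add: z_def q_def)
  qed
  then have "(\<Prod>n=2..<N. \<Prod>j<m. step_factor m \<delta> R n j) =
      (\<Prod>n=2..<N. \<Prod>j<m. (1 + real (later_count R n j) / attach_norm m \<delta> n j) *
        (if (Suc n, Suc j) \<in> snd ` R then h (n, j) else 1))"
    by (intro prod.cong) auto
  also have "\<dots> = (\<Prod>n=2..<N. \<Prod>j<m. 1 + real (later_count R n j) / attach_norm m \<delta> n j) *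
      (\<Prod>n=2..<N. \<Prod>j<m. if (Suc n, Suc j) \<in> snd ` R then h (n, j) else 1)"
    by (simp add: prod.distrib)
  also have "(\<Prod>n=2..<N. \<Prod>j<m. if (Suc n, Suc j) \<in> snd ` R then h (n, j) else 1) =
      (\<Prod>p\<in>{2..<N} \<times> {..<m}. if (Suc (fst p), Suc (snd p)) \<in> snd ` R then h p else 1)"
    by (subst prod.cartesian_product) (intro prod.cong refl, simp add: case_prod_beta')
  also have "\<dots> = (\<Prod>p\<in>req. h p)"
    unfolding req_def by (intro prod.inter_filter[symmetric]) simp
  \<comment> \<open>Steps are named by the state before them: the slot \<open>(v, l)\<close> is
    filled by step \<open>(v - 1, l - 1)\<close>, and steps start at \<open>n = 2\<close>.\<close>
  also have "\<dots> = (\<Prod>p\<in>{p \<in> snd ` R. fst p \<ge> 3}. required_factor R p)"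
  proof (rule prod.reindex_bij_witness[where i = "\<lambda>(v, l). (v - 1, l - 1)"
        and j = "\<lambda>(n, j). (Suc n, Suc j)"])
    fix p assume "p \<in> {p \<in> snd ` R. fst p \<ge> 3}"
    then obtain u v l where p: "p = (v, l)" "(u, v, l) \<in> R" "v \<ge> 3" by auto
    then have "l \<in> {1..m}" using R by (auto simp: valid_edges_def)
    then show "(case p of (v, l) \<Rightarrow> (v - 1, l - 1)) \<in> req"
      "(case case p of (v, l) \<Rightarrow> (v - 1, l - 1) of (n, j) \<Rightarrow> (Suc n, Suc j)) = p"
      using p le p(2) by (force simp: req_def image_iff)+
  qed (auto simp: req_def required_factor_def h_def intro: rev_image_eqI)
  also have "\<dots> = (\<Prod>p\<in>snd ` R. required_factor R p)"
    using fin by (intro prod.mono_neutral_left) (auto simp: required_factor_def split: if_splits)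
  also have "\<dots> = (\<Prod>e\<in>R. required_factor R (snd e))"
    using R by (simp add: prod.reindex valid_edges_def)
  finally show ?thesis .
qed

text \<open>The lower constant comes from \<open>attach_norm_le\<close> and a pending count of at
  most \<open>K\<close>. In the upper one, \<open>2 / \<epsilon>\<close> comes from
  \<open>v - 1 \<ge> v / 2\<close>, and the additional 2 covers \<open>v = 2\<close>, where the
  factor is 1.\<close>

lemma required_factor_bounds:
  assumes R: "valid_edges m R" "card R \<le> K" and e: "(u, v, l) \<in> R"
  shows "1 / (3 * real m + \<bar>\<delta>\<bar> + real K) * (1 / real v) \<le> required_factor R (v, l)"
    "required_factor R (v, l) \<le> (2 + 2 / \<epsilon>) * (1 / real v)"
proof -
  define d where "d = 3 * real m + \<bar>\<delta>\<bar> + real K"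
  have d: "d \<ge> 1" using m_pos by (simp add: d_def)
  have v: "v \<ge> 2" "l \<in> {1..m}" using R e by (auto simp: valid_edges_def)
  have "1 / d * (1 / real v) \<le> required_factor R (v, l) \<and>
      required_factor R (v, l) \<le> (2 + 2 / \<epsilon>) * (1 / real v)"
  proof (cases "v = 2")
    case True
    have "1 / d * (1 / 2) \<le> 1 * 1" using d by (intro mult_mono) auto
    then show ?thesis using True \<epsilon>_pos by (simp add: required_factor_def field_simps)
  next
    case False
    define x where "x = attach_norm m \<delta> (v - 1) (l - 1) + real (later_count R (v - 1) (l - 1))"
    have rf: "required_factor R (v, l) = 1 / x"
      using False v by (simp add: required_factor_def x_def)
    have n: "v - 1 \<ge> 2" "l - 1 < m" using v False by auto
    have "real v / 2 * \<epsilon> \<le> real (v - 1) * \<epsilon>"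
      using v \<epsilon>_pos by (intro mult_right_mono) auto
    also have "\<dots> \<le> x"
      using attach_norm_ge[OF n(1), of "l - 1"] by (simp add: x_def)
    finally have x_ge: "real v / 2 * \<epsilon> \<le> x" .
    have "x \<le> real (v - 1) * (3 * real m + \<bar>\<delta>\<bar>) + real K"
      using attach_norm_le[OF n] later_count_le[OF R(1), of "v - 1" "l - 1"] R(2)
      by (simp add: x_def)
    also have "\<dots> \<le> real v * (3 * real m + \<bar>\<delta>\<bar>) + real v * real K"
      using v mult_right_mono[of 1 "real v" "real K"] by (intro add_mono mult_right_mono) auto
    finally have x_le: "x \<le> d * real v" by (simp add: d_def algebra_simps)
    have pos: "0 < real v / 2 * \<epsilon>" using v \<epsilon>_pos by simp
    have "1 / (d * real v) \<le> 1 / x"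
      using x_le x_ge pos d v by (intro divide_left_mono) (auto intro: mult_pos_pos)
    moreover have "1 / x \<le> 1 / (real v / 2 * \<epsilon>)"
      using x_ge pos by (intro divide_left_mono) (auto intro: mult_pos_pos)
    moreover have "1 / (real v / 2 * \<epsilon>) = 2 / \<epsilon> * (1 / real v)"
      by (simp add: mult.commute)
    moreover have "2 / \<epsilon> * (1 / real v) \<le> (2 + 2 / \<epsilon>) * (1 / real v)"
      by (intro mult_right_mono) auto
    ultimately show ?thesis unfolding rf by (simp add: mult.commute)
  qed
  then show "1 / (3 * real m + \<bar>\<delta>\<bar> + real K) * (1 / real v) \<le> required_factor R (v, l)"
    "required_factor R (v, l) \<le> (2 + 2 / \<epsilon>) * (1 / real v)"
    by (simp_all add: d_def)
qed

lemma prod_required_bounds: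
  assumes R: "valid_edges m R" "card R \<le> K"
  shows "(1 / (3 * real m + \<bar>\<delta>\<bar> + real K)) ^ K * (\<Prod>(u, v, l)\<in>R. 1 / real v) \<le>
      (\<Prod>e\<in>R. required_factor R (snd e))"
    "(\<Prod>e\<in>R. required_factor R (snd e)) \<le> (2 + 2 / \<epsilon>) ^ K * (\<Prod>(u, v, l)\<in>R. 1 / real v)"
proof -
  define c where "c = 1 / (3 * real m + \<bar>\<delta>\<bar> + real K)"
  define C where "C = 2 + 2 / \<epsilon>"
  let ?V = "\<Prod>(u, v, l)\<in>R. 1 / real v"
  have c: "0 < c" "c \<le> 1" using m_pos by (auto simp: c_def add_pos_nonneg)
  have C: "1 \<le> C" using \<epsilon>_pos by (simp add: C_def)
  have V: "0 \<le> ?V" by (intro prod_nonneg) auto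
  have bnd: "c * (case e of (u, v, l) \<Rightarrow> 1 / real v) \<le> required_factor R (snd e)"
    "required_factor R (snd e) \<le> C * (case e of (u, v, l) \<Rightarrow> 1 / real v)" if "e \<in> R" for e
    using required_factor_bounds[OF R, of "fst e" "fst (snd e)" "snd (snd e)"] that
    by (simp_all add: c_def C_def split_def)
  have "c ^ K * ?V \<le> c ^ card R * ?V"
    using c R V by (intro mult_right_mono power_decreasing) auto
  also have "\<dots> = (\<Prod>e\<in>R. c * (case e of (u, v, l) \<Rightarrow> 1 / real v))"
    by (simp add: prod.distrib)
  also have "\<dots> \<le> (\<Prod>e\<in>R. required_factor R (snd e))"
    using bnd(1) c by (intro prod_mono) auto
  finally show "(1 / (3 * real m + \<bar>\<delta>\<bar> + real K)) ^ K * ?V \<le> (\<Prod>e\<in>R. required_factor R (snd e))"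
    by (simp add: c_def)
  have "0 \<le> required_factor R (snd e)" if "e \<in> R" for e
  proof -
    have "0 \<le> c * (case e of (u, v, l) \<Rightarrow> 1 / real v)"
      using c by (auto split: prod.split)
    then show ?thesis using bnd(1)[OF that] by linarith
  qed
  then have "(\<Prod>e\<in>R. required_factor R (snd e)) \<le> (\<Prod>e\<in>R. C * (case e of (u, v, l) \<Rightarrow> 1 / real v))"
    using bnd(2) by (intro prod_mono) auto
  also have "\<dots> = C ^ card R * ?V"
    by (simp add: prod.distrib)
  also have "\<dots> \<le> C ^ K * ?V"
    using C R V by (intro mult_right_mono power_increasing) auto
  finally show "(\<Prod>e\<in>R. required_factor R (snd e)) \<le> (2 + 2 / \<epsilon>) ^ K * ?V"
    by (simp add: C_def)
qed

end

context pa_model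
begin

text \<open>The constants depend on \<open>K\<close> but not on \<open>R\<close> or
  \<open>N\<close>; this uniformity permits summing the estimate over all placements.\<close>

lemma prob_edges_bounds:
  obtains c C :: real where "0 < c" "0 < C"
    "\<And>R N. valid_edges m R \<Longrightarrow> card R \<le> K \<Longrightarrow> N \<ge> 2 \<Longrightarrow> fst ` snd ` R \<subseteq> {..N} \<Longrightarrow>
       c * (\<Prod>(u, v, l)\<in>R. real u powr - \<kappa> * real v powr (\<kappa> - 1)) \<le>
         prob {\<omega> \<in> space M. R \<subseteq> hist N 0 \<omega>}"
    "\<And>R N. valid_edges m R \<Longrightarrow> card R \<le> K \<Longrightarrow> N \<ge> 2 \<Longrightarrow> fst ` snd ` R \<subseteq> {..N} \<Longrightarrow>
       prob {\<omega> \<in> space M. R \<subseteq> hist N 0 \<omega>} \<le>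
         C * (\<Prod>(u, v, l)\<in>R. real u powr - \<kappa> * real v powr (\<kappa> - 1))"
proof -
  define a1 where "a1 = min 1 \<epsilon> ^ K"
  define b1 where "b1 = exp (- growth_error K)"
  define c1 where "c1 = (1 / (3 * real m + \<bar>\<delta>\<bar> + real K)) ^ K"
  define a2 where "a2 = (1 + \<epsilon> + real K) ^ K"
  define b2 where "b2 = exp (growth_error K)"
  define c2 where "c2 = (2 + 2 / \<epsilon>) ^ K"
  have pos: "a1 > 0" "b1 > 0" "c1 > 0" "a2 > 0" "b2 > 0" "c2 > 0"
    using \<epsilon>_pos m_pos
    by (auto simp: a1_def b1_def c1_def a2_def b2_def c2_def add_pos_nonneg add_pos_pos)
  have main: "a1 * (b1 * c1) * (\<Prod>(u, v, l)\<in>R. real u powr - \<kappa> * real v powr (\<kappa> - 1)) \<le>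
         prob {\<omega> \<in> space M. R \<subseteq> hist N 0 \<omega>}"
      "prob {\<omega> \<in> space M. R \<subseteq> hist N 0 \<omega>} \<le>
         a2 * (b2 * c2) * (\<Prod>(u, v, l)\<in>R. real u powr - \<kappa> * real v powr (\<kappa> - 1))"
    if R: "valid_edges m R" "card R \<le> K" and N: "N \<ge> 2" "fst ` snd ` R \<subseteq> {..N}" for R N
  proof -
    define x where "x = (\<Prod>i=1..N. pochhammer \<epsilon> (pending R 2 0 i))"
    define y where "y = (\<Prod>n=2..<N. \<Prod>j<m. 1 + real (later_count R n j) / attach_norm m \<delta> n j)"
    define z where "z = (\<Prod>e\<in>R. required_factor R (snd e))"
    define W where "W = (\<Prod>(u, v, l)\<in>R. real u powr - \<kappa> * real v powr \<kappa>)"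
    define V where "V = (\<Prod>(u, v, l)\<in>R. 1 / real v)"
    have prob: "prob {\<omega> \<in> space M. R \<subseteq> hist N 0 \<omega>} = x * (y * z)"
      unfolding prob_edges_eq[OF R(1) N] prod_step_factor_split[OF R(1) N(2)] x_def y_def z_def \<epsilon>_def
      by simp
    \<comment> \<open>The growth part carries \<open>v powr \<kappa>\<close> per edge and the
      attachment itself \<open>1 / v\<close>; together they give the exponent
      \<open>\<kappa> - 1\<close>.\<close>
    have "W * V = (\<Prod>(u, v, l)\<in>R. real u powr - \<kappa> * real v powr (\<kappa> - 1))"
      unfolding W_def V_def prod.distrib[symmetric]
      by (intro prod.cong refl) (auto simp: powr_diff split: prod.split)
    then have WV: "(\<Prod>(u, v, l)\<in>R. real u powr - \<kappa> * real v powr (\<kappa> - 1)) = W * V" by simp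
    have nn: "0 \<le> W" "0 \<le> V"
      unfolding W_def V_def by (intro prod_nonneg; auto)+
    note x = prod_pochhammer_bounds[OF R, of N, folded x_def a1_def a2_def]
    note y = prod_growth_bounds[OF R N(2), folded y_def W_def b1_def b2_def]
    note z = prod_required_bounds[OF R, folded z_def V_def c1_def c2_def]
    have nn': "0 \<le> b1 * W" "0 \<le> c1 * V" using pos nn by auto
    have nn'': "0 \<le> x" "0 \<le> y" "0 \<le> z" using x y z pos nn' by linarith+
    have "a1 * ((b1 * W) * (c1 * V)) \<le> x * (y * z)"
      using x y z pos nn' nn'' by (intro mult_mono) auto
    then show "a1 * (b1 * c1) * (\<Prod>(u, v, l)\<in>R. real u powr - \<kappa> * real v powr (\<kappa> - 1)) \<le>
         prob {\<omega> \<in> space M. R \<subseteq> hist N 0 \<omega>}"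
      unfolding WV prob by (simp add: mult_ac)
    have "x * (y * z) \<le> a2 * ((b2 * W) * (c2 * V))"
      using x y z pos nn nn'' by (intro mult_mono) auto
    then show "prob {\<omega> \<in> space M. R \<subseteq> hist N 0 \<omega>} \<le>
         a2 * (b2 * c2) * (\<Prod>(u, v, l)\<in>R. real u powr - \<kappa> * real v powr (\<kappa> - 1))"
      unfolding WV prob by (simp add: mult_ac)
  qed
  show thesis
    by (rule that[of "a1 * (b1 * c1)" "a2 * (b2 * c2)"]) (use pos main in auto)
qed

end

section \<open>Sums over increasing sequences\<close>

lemma bigtheta_shift:
  fixes f g :: "nat \<Rightarrow> real"
  assumes "f \<in> \<Theta>(g)"
  shows "(\<lambda>n. f (n - 1)) \<in> \<Theta>(\<lambda>n. g (n - 1))"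
proof -
  have "filterlim (\<lambda>n::nat. n - 1) at_top at_top"
    by (rule filterlim_minus_const_nat_at_top)
  then show ?thesis
    using assms by (rule landau_theta.compose[rotated])
qed

lemma bigtheta_sequence_bounds:
  fixes f g :: "nat \<Rightarrow> real"
  assumes "f \<in> \<Theta>(g)" and "eventually (\<lambda>n. f n \<ge> 0) sequentially"
    and "eventually (\<lambda>n. g n \<ge> 0) sequentially"
  shows "\<exists>a b N. 0 < a \<and> (\<forall>n\<ge>N. a * g n \<le> f n \<and> f n \<le> b * g n)"
proof -
  from assms(1) obtain b where b: "b > 0" "eventually (\<lambda>n. norm (f n) \<le> b * norm (g n)) sequentially"
    by (auto elim!: landau_o.bigE)
  from assms(1) obtain a where a: "a > 0" "eventually (\<lambda>n. norm (f n) \<ge> a * norm (g n)) sequentially"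
    by (auto elim!: landau_omega.bigE)
  have "eventually (\<lambda>n. a * g n \<le> f n \<and> f n \<le> b * g n) sequentially"
    using a(2) b(2) assms(2,3) by eventually_elim auto
  with a(1) show ?thesis by (auto simp: eventually_sequentially)
qed

lemma bigtheta_sequenceI:
  fixes f g :: "nat \<Rightarrow> real"
  assumes "a > 0" and "eventually (\<lambda>n. a * g n \<le> f n) sequentially"
    and "eventually (\<lambda>n. f n \<le> b * g n) sequentially" and "eventually (\<lambda>n. g n \<ge> 0) sequentially"
  shows "f \<in> \<Theta>(g)"
proof (rule bigthetaI')
  show "a > 0" by fact
  \<comment> \<open>\<open>b\<close> is not assumed positive.\<close>
  show "max b 1 > 0" by simp
  show "eventually (\<lambda>n. norm (f n) \<ge> a * norm (g n) \<and> norm (f n) \<le> max b 1 * norm (g n)) sequentially"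
    using assms(2-4)
  proof eventually_elim
    case (elim n)
    have "b * g n \<le> max b 1 * g n" using elim by (intro mult_right_mono) auto
    moreover have "0 \<le> a * g n" using elim assms(1) by simp
    ultimately show ?case using elim by simp
  qed
qed

text \<open>A discrete Stolz--Cesaro argument: summing the increments of \<open>G\<close> telescopes.\<close>

lemma bigtheta_partial_sums:
  fixes f G :: "nat \<Rightarrow> real"
  assumes f: "f \<in> \<Theta>(\<lambda>n. G n - G (n - 1))" and f_nonneg: "\<And>n. f n \<ge> 0"
    and incr: "eventually (\<lambda>n. G n - G (n - 1) \<ge> 0) sequentially"
    and G: "filterlim G at_top sequentially"
  shows "(\<lambda>n. \<Sum>x=1..n. f x) \<in> \<Theta>(G)"
proof -
  have ev: "eventually (\<lambda>n. f n \<ge> 0) sequentially" by (simp add: f_nonneg)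
  obtain a b N0 where "0 < a \<and> (\<forall>n\<ge>N0. a * (G n - G (n - 1)) \<le> f n \<and> f n \<le> b * (G n - G (n - 1)))"
    using bigtheta_sequence_bounds[OF f ev incr] by (elim exE)
  then have ab: "0 < a" "\<And>n. n \<ge> N0 \<Longrightarrow> a * (G n - G (n - 1)) \<le> f n"
    "\<And>n. n \<ge> N0 \<Longrightarrow> f n \<le> b * (G n - G (n - 1))" by auto
  define N where "N = max N0 1"
  define F where "F n = (\<Sum>x=1..n. f x)" for n
  have F0: "F n \<ge> 0" for n unfolding F_def using f_nonneg by (intro sum_nonneg)
  have bounds: "a * (G n - G N) \<le> F n - F N \<and> F n - F N \<le> b * (G n - G N)" if "n \<ge> N" for n
    using that
  proof (induction n rule: dec_induct)
    case (step n)
    have "a * (G (Suc n) - G n) \<le> f (Suc n)" "f (Suc n) \<le> b * (G (Suc n) - G n)"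
      using ab(2,3)[of "Suc n"] step by (auto simp: N_def)
    moreover have "F (Suc n) = F n + f (Suc n)" by (simp add: F_def)
    ultimately show ?case using step by (simp add: algebra_simps)
  qed simp
  have "F \<in> \<Theta>(G)"
  proof (rule bigtheta_sequenceI)
    show "a / 2 > 0" using ab by simp
    have big: "eventually (\<lambda>n. G n \<ge> C) sequentially" for C
      using G by (auto simp: filterlim_at_top)
    \<comment> \<open>Once \<open>G n\<close> exceeds \<open>2 * G N\<close>, the increment
      \<open>G n - G N\<close> is at least half of \<open>G n\<close>; this costs the factor
      2.\<close>
    show "eventually (\<lambda>n. a / 2 * G n \<le> F n) sequentially"
      using big[of "2 * G N"] eventually_ge_at_top[of N]
    proof eventually_elim
      case (elim n)
      have "a * (G n / 2) \<le> a * (G n - G N)"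
        using elim ab(1) by (intro mult_left_mono) auto
      then show ?case using bounds[of n] elim F0[of N] by linarith
    qed
    \<comment> \<open>The constant \<open>F N - b * G N\<close> left over from the start of the sum
      is absorbed into one further copy of \<open>G n\<close>.\<close>
    show "eventually (\<lambda>n. F n \<le> (b + 1) * G n) sequentially"
      using big[of "F N - b * G N"] eventually_ge_at_top[of N]
    proof eventually_elim
      case (elim n)
      then show ?case using bounds[of n] by (simp add: algebra_simps)
    qed
    show "eventually (\<lambda>n. 0 \<le> G n) sequentially" by (rule big)
  qed
  then show ?thesis by (simp add: F_def[abs_def])
qed

text \<open>Here \<open>G n\<close> is the claimed order itself; its increments are of order
  \<open>n powr (c - 1)\<close> times the same power of the logarithm.\<close>

lemma bigtheta_power_log_sum_pos:
  fixes f :: "nat \<Rightarrow> real"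
  assumes f: "f \<in> \<Theta>(\<lambda>n. real n powr (c - 1) * ln (real n) ^ p)" and "\<And>n. f n \<ge> 0" and c: "c > 0"
  shows "(\<lambda>n. \<Sum>x=1..n. f x) \<in> \<Theta>(\<lambda>n. real n powr c * ln (real n) ^ p)"
proof (rule bigtheta_partial_sums)
  \<comment> \<open>Subtraction in the reals replaces truncated subtraction. The two agree from
    \<open>n = 1\<close> on, and only the real version has an asymptotic expansion to
    compute.\<close>
  let ?D = "\<lambda>n::nat. real n powr c * ln (real n) ^ p - (real n - 1) powr c * ln (real n - 1) ^ p"
  have ev: "eventually (\<lambda>n. ?D n = real n powr c * ln (real n) ^ p -
      real (n - 1) powr c * ln (real (n - 1)) ^ p) sequentially"
    using eventually_ge_at_top[of 1] by eventually_elim (simp add: of_nat_diff)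
  have "?D \<in> \<Theta>(\<lambda>n. real n powr (c - 1) * ln (real n) ^ p)"
    using c by real_asymp
  then have "f \<in> \<Theta>(?D)"
    using f bigtheta_sym landau_theta.trans by blast
  then show "f \<in> \<Theta>(\<lambda>n. real n powr c * ln (real n) ^ p - real (n - 1) powr c * ln (real (n - 1)) ^ p)"
    using landau_theta.cong[OF ev] by simp
  have "eventually (\<lambda>n. ?D n \<ge> 0) sequentially"
    using c by real_asymp
  with ev show "eventually (\<lambda>n. real n powr c * ln (real n) ^ p -
      real (n - 1) powr c * ln (real (n - 1)) ^ p \<ge> 0) sequentially"
    by eventually_elim simp
  show "filterlim (\<lambda>n. real n powr c * ln (real n) ^ p) at_top sequentially"
    using c by real_asymp
qed (fact assms)

text \<open>The borderline exponent -1: increments of the next power of the logarithm have exactly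
  this order. Logarithms in the final answer originate here.\<close>

lemma bigtheta_power_log_sum_zero:
  fixes f :: "nat \<Rightarrow> real"
  assumes f: "f \<in> \<Theta>(\<lambda>n. real n powr (0 - 1) * ln (real n) ^ p)" and "\<And>n. f n \<ge> 0"
  shows "(\<lambda>n. \<Sum>x=1..n. f x) \<in> \<Theta>(\<lambda>n. ln (real n) ^ (p + 1))"
proof (rule bigtheta_partial_sums)
  let ?D = "\<lambda>n::nat. ln (real n) ^ (p + 1) - ln (real n - 1) ^ (p + 1)"
  have ev: "eventually (\<lambda>n. ?D n = ln (real n) ^ (p + 1) - ln (real (n - 1)) ^ (p + 1)) sequentially"
    using eventually_ge_at_top[of 1] by eventually_elim (simp add: of_nat_diff)
  have "?D \<in> \<Theta>(\<lambda>n. real n powr (0 - 1) * ln (real n) ^ p)"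
    by real_asymp
  then have "f \<in> \<Theta>(?D)"
    using f bigtheta_sym landau_theta.trans by blast
  then show "f \<in> \<Theta>(\<lambda>n. ln (real n) ^ (p + 1) - ln (real (n - 1)) ^ (p + 1))"
    using landau_theta.cong[OF ev] by simp
  have "eventually (\<lambda>n. ?D n \<ge> 0) sequentially"
    by real_asymp
  with ev show "eventually (\<lambda>n. ln (real n) ^ (p + 1) - ln (real (n - 1)) ^ (p + 1) \<ge> 0) sequentially"
    by eventually_elim simp
  show "filterlim (\<lambda>n. ln (real n) ^ (p + 1)) at_top sequentially"
    by real_asymp
qed (fact assms)

text \<open>The series converges, so its value bounds the partial sums from above. A single positive
  term suffices from below.\<close>

lemma bigtheta_power_log_sum_neg:
  fixes f :: "nat \<Rightarrow> real"
  assumes f: "f \<in> \<Theta>(\<lambda>n. real n powr (c - 1) * ln (real n) ^ p)" and nonneg: "\<And>n. f n \<ge> 0"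
    and c: "c < 0"
  shows "(\<lambda>n. \<Sum>x=1..n. f x) \<in> \<Theta>(\<lambda>n. 1)"
proof -
  have "f \<in> O(\<lambda>n. real n powr (c - 1) * ln (real n) ^ p)"
    using f by auto
  \<comment> \<open>Half of the negative exponent absorbs the logarithms, and
    \<open>c / 2 - 1 < -1\<close> is still summable.\<close>
  also have "(\<lambda>n. real n powr (c - 1) * ln (real n) ^ p) \<in> O(\<lambda>n. real n powr (c / 2 - 1))"
    using c by real_asymp
  finally have f_O: "f \<in> O(\<lambda>n. real n powr (c / 2 - 1))" .
  have "summable (\<lambda>n. real n powr (c / 2 - 1))"
    using c by (subst summable_real_powr_iff) simp
  then have "summable (\<lambda>n. norm (real n powr (c / 2 - 1)))"
    by simp
  then have summ: "summable f"
    using f_O by (rule summable_comparison_test_bigo)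
  have pos: "eventually (\<lambda>n::nat. real n powr (c - 1) * ln (real n) ^ p > 0) sequentially"
    using eventually_gt_at_top[of 1] by eventually_elim simp
  have pos': "eventually (\<lambda>n::nat. real n powr (c - 1) * ln (real n) ^ p \<ge> 0) sequentially"
    using pos by (rule eventually_mono) (rule less_imp_le)
  have ev: "eventually (\<lambda>n. f n \<ge> 0) sequentially" by (simp add: nonneg)
  obtain a b N where "0 < a \<and> (\<forall>n\<ge>N. a * (real n powr (c - 1) * ln (real n) ^ p) \<le> f n \<and>
      f n \<le> b * (real n powr (c - 1) * ln (real n) ^ p))"
    using bigtheta_sequence_bounds[OF f ev pos'] by (elim exE)
  then have a: "0 < a" "\<And>n. n \<ge> N \<Longrightarrow> a * (real n powr (c - 1) * ln (real n) ^ p) \<le> f n"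
    by auto
  obtain n0 where "real n0 powr (c - 1) * ln (real n0) ^ p > 0 \<and> n0 \<ge> max N 1"
    using eventually_happens'[OF sequentially_bot eventually_conj[OF pos eventually_ge_at_top[of "max N 1"]]]
    by (elim exE)
  then have n0: "n0 \<ge> N" "n0 \<ge> 1" "real n0 powr (c - 1) * ln (real n0) ^ p > 0"
    by simp_all
  have "f n0 > 0"
    using a(2)[OF n0(1)] mult_pos_pos[OF a(1) n0(3)] by linarith
  show ?thesis
  proof (rule bigtheta_sequenceI)
    show "f n0 > 0" by fact
    show "eventually (\<lambda>n. f n0 * 1 \<le> (\<Sum>x=1..n. f x)) sequentially"
      using eventually_ge_at_top[of n0]
    proof eventually_elim
      case (elim n)
      then show ?case using nonneg n0 by (auto intro!: member_le_sum)
    qed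
    show "eventually (\<lambda>n. (\<Sum>x=1..n. f x) \<le> suminf f * 1) sequentially"
      using sum_le_suminf[OF summ] nonneg by simp
  qed simp
qed

section \<open>The recursion for iterated sums and its closed form\<close>

fun chain_sum :: "(nat \<Rightarrow> real) \<Rightarrow> nat \<Rightarrow> nat \<Rightarrow> real" where
  "chain_sum b 0 n = 1"
| "chain_sum b (Suc k) n = (\<Sum>x=1..n. real x powr b (Suc k) * chain_sum b k (x - 1))"

fun chain_exponent :: "(nat \<Rightarrow> real) \<Rightarrow> nat \<Rightarrow> real" where
  "chain_exponent b 0 = 0"
| "chain_exponent b (Suc k) = max (chain_exponent b k + (1 + b (Suc k))) 0"

fun chain_ties :: "(nat \<Rightarrow> real) \<Rightarrow> nat \<Rightarrow> nat" where
  "chain_ties b 0 = 0"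
| "chain_ties b (Suc k) =
    (if chain_exponent b k + (1 + b (Suc k)) > 0 then chain_ties b k
     else if chain_exponent b k + (1 + b (Suc k)) = 0 then chain_ties b k + 1 else 0)"

lemma chain_sum_nonneg: "chain_sum b k n \<ge> 0"
  by (induction k arbitrary: n) (auto intro!: sum_nonneg)

lemma chain_sum_bigtheta:
  "chain_sum b k \<in> \<Theta>(\<lambda>n. real n powr chain_exponent b k * ln (real n) ^ chain_ties b k)"
proof (induction k)
  case 0
  \<comment> \<open>Only eventually, since \<open>0 powr 0 = 0\<close>.\<close>
  have "eventually (\<lambda>n::nat. 1 = real n powr 0 * ln (real n) ^ 0) sequentially"
    using eventually_ge_at_top[of 1] by eventually_elim simp
  then show ?case by (auto intro: bigthetaI_cong)
next
  case (Suc k)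
  define A p c where "A = chain_exponent b k" and "p = chain_ties b k" and "c = A + (1 + b (Suc k))"
  define f where "f x = real x powr b (Suc k) * chain_sum b k (x - 1)" for x
  have f0: "f n \<ge> 0" for n by (simp add: f_def chain_sum_nonneg)
  have "(\<lambda>n. chain_sum b k (n - 1)) \<in> \<Theta>(\<lambda>n. real (n - 1) powr A * ln (real (n - 1)) ^ p)"
    unfolding A_def p_def by (rule bigtheta_shift[OF Suc.IH])
  also have "(\<lambda>n. real (n - 1) powr A * ln (real (n - 1)) ^ p) \<in>
      \<Theta>(\<lambda>n. (real n - 1) powr A * ln (real n - 1) ^ p)"
    by (rule bigthetaI_cong, use eventually_ge_at_top[of 1] in eventually_elim) (simp add: of_nat_diff)
  also have "(\<lambda>n. (real n - 1) powr A * ln (real n - 1) ^ p) \<in> \<Theta>(\<lambda>n. real n powr A * ln (real n) ^ p)"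
    by real_asymp
  finally have "f \<in> \<Theta>(\<lambda>n. real n powr b (Suc k) * (real n powr A * ln (real n) ^ p))"
    unfolding f_def[abs_def] by (intro landau_theta.mult bigthetaI_cong[OF always_eventually[OF allI[OF refl]]])
  then have f: "f \<in> \<Theta>(\<lambda>n. real n powr (c - 1) * ln (real n) ^ p)"
    by (simp add: c_def powr_add[symmetric] mult.assoc[symmetric] add_ac)
  have eq: "chain_sum b (Suc k) = (\<lambda>n. \<Sum>x=1..n. f x)"
    by (simp add: f_def fun_eq_iff)
  consider "c > 0" | "c = 0" | "c < 0" by linarith
  then show ?case
  proof cases
    case 1
    then show ?thesis
      using bigtheta_power_log_sum_pos[OF f f0] unfolding eq by (simp add: c_def A_def p_def)
  next
    case 2
    have "(\<lambda>n::nat. ln (real n) ^ (p + 1)) \<in> \<Theta>(\<lambda>n. real n powr 0 * ln (real n) ^ (p + 1))"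
      by (rule bigthetaI_cong, use eventually_ge_at_top[of 1] in eventually_elim) simp
    then have "(\<lambda>n. \<Sum>x=1..n. f x) \<in> \<Theta>(\<lambda>n. real n powr 0 * ln (real n) ^ (p + 1))"
      using bigtheta_power_log_sum_zero[OF f[unfolded 2] f0] landau_theta.trans by blast
    then show ?thesis
      using 2 unfolding eq by (simp add: c_def A_def p_def)
  next
    case 3
    have "(\<lambda>n::nat. 1) \<in> \<Theta>(\<lambda>n. real n powr 0 * ln (real n) ^ 0)"
      by (rule bigthetaI_cong, use eventually_ge_at_top[of 1] in eventually_elim) simp
    then have "(\<lambda>n. \<Sum>x=1..n. f x) \<in> \<Theta>(\<lambda>n. real n powr 0 * ln (real n) ^ 0)"
      using bigtheta_power_log_sum_neg[OF f f0 3] landau_theta.trans by blast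
    then show ?thesis
      using 3 unfolding eq by (simp add: c_def A_def p_def)
  qed
qed

text \<open>Passing from \<open>k\<close> to \<open>k + 1\<close> shifts all old sums by the same
  amount and adds one new candidate, the empty sum 0 at \<open>s = k + 1\<close>. That candidate is
  below the shifted maximum, ties with it, or becomes the sole maximizer: the three cases of
  \<open>chain_ties\<close>.\<close>

lemma chain_exponent_Max:
  "chain_exponent b k = Max ((\<lambda>s. \<Sum>i=s+1..k. 1 + b i) ` {0..k})"
  and chain_ties_card:
  "card {s \<in> {0..k}. (\<Sum>i=s+1..k. 1 + b i) = chain_exponent b k} = Suc (chain_ties b k)"
proof (induction k)
  case 0
  have "{s. s = 0 \<and> (\<Sum>i=s+1..0. 1 + b i) = 0} = {0}" by auto
  {
    case 1 show ?case by simp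
  next
    case 2 show ?case using \<open>_ = {0}\<close> by simp
  }
next
  case (Suc k)
  define S where "S s = (\<Sum>i=s+1..k. 1 + b i)" for s
  define x where "x = 1 + b (Suc k)"
  have S_Suc: "(\<Sum>i=s+1..Suc k. 1 + b i) = S s + x" if "s \<le> k" for s
    using that by (simp add: S_def x_def)
  have split: "{0..Suc k} = insert (Suc k) {0..k}" by auto
  have S_le: "S s \<le> chain_exponent b k" if "s \<le> k" for s
    using that unfolding Suc.IH(1) S_def by (intro Max_ge) auto
  have "(\<lambda>s. \<Sum>i=s+1..Suc k. 1 + b i) ` {0..Suc k} = insert 0 ((\<lambda>y. y + x) ` S ` {0..k})"
  proof -
    have "(\<lambda>s. \<Sum>i=s+1..Suc k. 1 + b i) ` {0..k} = (\<lambda>s. S s + x) ` {0..k}"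
      by (intro image_cong refl S_Suc) simp
    then show ?thesis unfolding split image_insert image_image by simp
  qed
  moreover have "Max ((\<lambda>y. y + x) ` S ` {0..k}) = Max (S ` {0..k}) + x"
    by (subst mono_Max_commute[symmetric]) (auto intro: monoI)
  ultimately have Max_eq: "Max ((\<lambda>s. \<Sum>i=s+1..Suc k. 1 + b i) ` {0..Suc k}) = max 0 (chain_exponent b k + x)"
    unfolding Suc.IH(1) by (simp add: S_def)
  have cardS: "card {s \<in> {0..k}. S s = chain_exponent b k} = Suc (chain_ties b k)"
    using Suc.IH(2) by (simp add: S_def)
  {
    case 1 show ?case using Max_eq by (simp add: x_def max.commute)
  next
    case 2
    have e: "chain_exponent b (Suc k) = max (chain_exponent b k + x) 0" by (simp add: x_def)
    have set: "{s \<in> {0..Suc k}. (\<Sum>i=s+1..Suc k. 1 + b i) = chain_exponent b (Suc k)} =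
       {s \<in> {0..k}. S s + x = max (chain_exponent b k + x) 0} \<union>
       (if max (chain_exponent b k + x) 0 = 0 then {Suc k} else {})"
      unfolding e using S_Suc by (auto simp: split)
    consider "chain_exponent b k + x > 0" | "chain_exponent b k + x = 0" | "chain_exponent b k + x < 0"
      by linarith
    then show ?case
    proof cases
      case 1
      then show ?thesis unfolding set using cardS by (simp add: x_def)
    next
      case 2
      then have "{s \<in> {0..k}. S s + x = max (chain_exponent b k + x) 0} =
          {s \<in> {0..k}. S s = chain_exponent b k}" by auto
      then show ?thesis unfolding set using 2 cardS by (simp add: x_def)
    next
      case 3
      then have "{s \<in> {0..k}. S s + x = max (chain_exponent b k + x) 0} = {}"
        using S_le by fastforce
      then show ?thesis unfolding set using 3 by (simp add: x_def)
    qed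
  }
qed

section \<open>Counting placements\<close>

definition chains :: "nat \<Rightarrow> nat \<Rightarrow> (nat \<Rightarrow> nat) set" where
  "chains k n = {u \<in> {1..k} \<rightarrow>\<^sub>E {1..n}. strict_mono_on {1..k} u}"

lemma finite_chains: "finite (chains k n)"
  unfolding chains_def by (rule finite_subset[of _ "{1..k} \<rightarrow>\<^sub>E {1..n}"]) (auto intro: finite_PiE)

lemma chainsD:
  assumes "u \<in> chains k n"
  shows "\<And>i. i \<in> {1..k} \<Longrightarrow> u i \<in> {1..n}" "\<And>i j. i \<in> {1..k} \<Longrightarrow> j \<in> {1..k} \<Longrightarrow> i < j \<Longrightarrow> u i < u j"
    "inj_on u {1..k}" "u \<in> extensional {1..k}"
proof -
  show mono: "u i < u j" if "i \<in> {1..k}" "j \<in> {1..k}" "i < j" for i j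
    using assms that by (auto simp: chains_def strict_mono_on_def)
  show "u i \<in> {1..n}" if "i \<in> {1..k}" for i
    using assms that by (auto simp: chains_def PiE_iff)
  show "inj_on u {1..k}"
    by (intro linorder_inj_onI) (use mono in \<open>auto dest: less_imp_neq\<close>)
  show "u \<in> extensional {1..k}"
    using assms by (auto simp: chains_def PiE_def)
qed

text \<open>Splitting off the largest entry \<open>x\<close> leaves an arbitrary chain in
  \<open>{1..x - 1}\<close>, which is the recursion of \<open>chain_sum\<close>.\<close>

lemma sum_chains:
  "(\<Sum>u\<in>chains k n. \<Prod>i=1..k. real (u i) powr b i) = chain_sum b k n"
proof (induction k arbitrary: n)
  case 0
  have "chains 0 n = {\<lambda>_. undefined}"
    by (auto simp: chains_def strict_mono_on_def)
  then show ?case by simp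
next
  case (Suc k)
  have "(\<Sum>u\<in>chains (Suc k) n. \<Prod>i=1..Suc k. real (u i) powr b i) =
    (\<Sum>p\<in>(SIGMA x:{1..n}. chains k (x - 1)).
       real (fst p) powr b (Suc k) * (\<Prod>i=1..k. real (snd p i) powr b i))"
  proof (rule sum.reindex_bij_witness[where j = "\<lambda>u. (u (Suc k), restrict u {1..k})"
        and i = "\<lambda>p. (snd p)(Suc k := fst p)"])
    fix u assume u: "u \<in> chains (Suc k) n"
    have u_lt: "u i < u (Suc k)" if "i \<in> {1..k}" for i
      using chainsD(2)[OF u, of i "Suc k"] that by auto
    have u_ge: "1 \<le> u i" if "i \<in> {1..k}" for i
      using chainsD(1)[OF u, of i] that by auto
    have "restrict u {1..k} \<in> chains k (u (Suc k) - 1)"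
      using u_lt u_ge chainsD(2)[OF u] by (force simp: chains_def strict_mono_on_def)
    then show "(u (Suc k), restrict u {1..k}) \<in> (SIGMA x:{1..n}. chains k (x - 1))"
      using chainsD(1)[OF u, of "Suc k"] by auto
    show "(snd (u (Suc k), restrict u {1..k}))(Suc k := fst (u (Suc k), restrict u {1..k})) = u"
      using chainsD(4)[OF u] by (auto simp: fun_eq_iff extensional_def le_Suc_eq)
    show "real (fst (u (Suc k), restrict u {1..k})) powr b (Suc k) *
        (\<Prod>i=1..k. real (snd (u (Suc k), restrict u {1..k}) i) powr b i) =
      (\<Prod>i=1..Suc k. real (u i) powr b i)"
      by (simp add: mult.commute)
  next
    fix p assume "p \<in> (SIGMA x:{1..n}. chains k (x - 1))"
    then obtain x w where p: "p = (x, w)" and x: "x \<in> {1..n}" and w: "w \<in> chains k (x - 1)"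
      by auto
    have w_lt: "1 \<le> w i \<and> w i < x" if "i \<in> {1..k}" for i
      using chainsD(1)[OF w that] x by auto
    have "w(Suc k := x) \<in> {1..Suc k} \<rightarrow>\<^sub>E {1..n}"
    proof (rule PiE_I)
      fix i assume "i \<in> {1..Suc k}"
      then show "(w(Suc k := x)) i \<in> {1..n}"
        using w_lt[of i] x by (cases "i = Suc k") auto
    next
      fix i assume "i \<notin> {1..Suc k}"
      then show "(w(Suc k := x)) i = undefined"
        using chainsD(4)[OF w] by (auto simp: extensional_def)
    qed
    moreover have "strict_mono_on {1..Suc k} (w(Suc k := x))"
    proof (rule strict_mono_onI)
      fix i j assume "i \<in> {1..Suc k}" "j \<in> {1..Suc k}" "i < j"
      then show "(w(Suc k := x)) i < (w(Suc k := x)) j"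
        using w_lt[of i] chainsD(2)[OF w, of i j] by (cases "j = Suc k") auto
    qed
    ultimately show "(snd p)(Suc k := fst p) \<in> chains (Suc k) n"
      by (simp add: chains_def p)
    show "(((snd p)(Suc k := fst p)) (Suc k), restrict ((snd p)(Suc k := fst p)) {1..k}) = p"
      using chainsD(4)[OF w] by (auto simp: p fun_eq_iff extensional_def)
  qed
  also have "\<dots> = (\<Sum>x=1..n. \<Sum>u\<in>chains k (x - 1).
      real x powr b (Suc k) * (\<Prod>i=1..k. real (u i) powr b i))"
    by (subst sum.Sigma) (auto simp: finite_chains split_def)
  also have "\<dots> = chain_sum b (Suc k) n"
    by (simp only: sum_distrib_left[symmetric] Suc.IH chain_sum.simps)
  finally show ?case .
qed

lemma chains_enumerate:
  assumes "V \<subseteq> {1..n}" "card V = k"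
  obtains u where "u \<in> chains k n" "u ` {1..k} = V"
proof -
  have fin: "finite V" using assms finite_subset by blast
  define xs where "xs = sorted_list_of_set V"
  have xs: "length xs = k" "set xs = V" "sorted_wrt (<) xs"
    using fin assms by (auto simp: xs_def)
  define u where "u = restrict (\<lambda>i. xs ! (i - 1)) {1..k}"
  have "u ` {1..k} = V"
  proof -
    have "u ` {1..k} = (\<lambda>i. xs ! (i - 1)) ` Suc ` {..<k}"
      unfolding u_def image_Suc_lessThan by auto
    also have "\<dots> = (!) xs ` {..<k}" by (simp add: image_image)
    also have "\<dots> = V" using xs by (auto simp: set_conv_nth)
    finally show ?thesis .
  qed
  moreover have "strict_mono_on {1..k} u"
    using sorted_wrt_nth_less[OF xs(3)] xs(1) by (auto simp: strict_mono_on_def u_def)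
  moreover have "u \<in> {1..k} \<rightarrow>\<^sub>E {1..n}"
  proof (rule PiE_I)
    fix i assume "i \<in> {1..k}"
    then show "u i \<in> {1..n}" using \<open>u ` {1..k} = V\<close> assms(1) by blast
  next
    fix i assume "i \<notin> {1..k}"
    then show "u i = undefined" by (simp only: u_def restrict_apply if_False)
  qed
  ultimately show ?thesis using that by (simp add: chains_def)
qed

text \<open>Together with \<open>chains_enumerate\<close> this identifies chains with the
  \<open>k\<close>-element subsets of \<open>{1..n}\<close>. It makes the vertex set of a copy
  determine the chain in the lower bound.\<close>

lemma chains_image_inj: "inj_on (\<lambda>u. u ` {1..k}) (chains k n)"
proof (rule inj_onI)
  fix u w assume u: "u \<in> chains k n" and w: "w \<in> chains k n" and eq: "u ` {1..k} = w ` {1..k}"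
  have sorted: "sorted_wrt (<) (map x [1..<Suc k])" if "x \<in> chains k n" for x
    unfolding sorted_wrt_map
    by (rule sorted_wrt_mono_rel[OF _ sorted_wrt_upt]) (use chainsD(2)[OF that] in auto)
  have "set (map u [1..<Suc k]) = set (map w [1..<Suc k])"
    using eq by (simp add: atLeastLessThanSuc_atLeastAtMost del: upt_Suc)
  then have "map u [1..<Suc k] = map w [1..<Suc k]"
    using sorted[OF u] sorted[OF w] by (intro strict_sorted_equal)
  then have "u i = w i" if "i \<in> {1..k}" for i
    using that by (auto simp del: upt_Suc)
  then show "u = w"
    using chainsD(4)[OF u] chainsD(4)[OF w] by (intro extensionalityI) auto
qed

text \<open>Injectivity of tail and label together says that different arcs use different edge
  slots; in particular parallel arcs receive different labels.\<close>

definition labelings :: "nat \<Rightarrow> ('a, 'b) pre_digraph \<Rightarrow> ('b \<Rightarrow> nat) set" where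
  "labelings m H = {g \<in> arcs H \<rightarrow>\<^sub>E {1..m}. inj_on (\<lambda>a. (tail H a, g a)) (arcs H)}"

definition place_arc ::
  "('a, 'b) pre_digraph \<Rightarrow> ('a \<Rightarrow> nat) \<Rightarrow> (nat \<Rightarrow> nat) \<Rightarrow> ('b \<Rightarrow> nat) \<Rightarrow> 'b \<Rightarrow> nat \<times> nat \<times> nat" where
  "place_arc H \<pi> u g a = (u (\<pi> (head H a)), u (\<pi> (tail H a)), g a)"

text \<open>The set of present edges is a parameter, so the count becomes a function of the history
  and the expectation formulas apply.\<close>

definition copies_in ::
  "nat \<Rightarrow> (nat \<times> nat \<times> nat) set \<Rightarrow> ('a, 'b) pre_digraph \<Rightarrow> (nat set \<times> (nat \<times> nat \<times> nat) set) set"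
where
  "copies_in t S H = {(V, A). V \<subseteq> {1..t} \<and> card V = card (verts H) \<and>
     A \<subseteq> S \<and> (\<forall>(u, v, j) \<in> A. u \<in> V \<and> v \<in> V) \<and> digraph_iso (edge_digraph V A) H}"

lemma num_copies_eq: "num_copies m e t H = card (copies_in t (pa_edges m e t) H)"
  by (simp add: num_copies_def copies_def copies_in_def)

section \<open>Copies as images of placements\<close>

context fin_digraph
begin

lemma finite_labelings: "finite (labelings m G)"
  unfolding labelings_def
  by (rule finite_subset[of _ "arcs G \<rightarrow>\<^sub>E {1..m}"]) (auto intro: finite_PiE)

lemma finite_attainable_orderings: "finite (attainable_orderings m G)"
proof (rule finite_subset)
  show "attainable_orderings m G \<subseteq> verts G \<rightarrow>\<^sub>E {1..card (verts G)}"
    by (auto simp: attainable_orderings_def orderings_def PiE_def bij_betw_def)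
qed (auto intro: finite_PiE)

text \<open>At each vertex the out-arcs inject into \<open>{1..m}\<close>. This supplies the one
  labeling needed for the lower bound.\<close>

lemma labelings_nonempty:
  assumes "\<And>x. x \<in> verts G \<Longrightarrow> out_degree G x \<le> m"
  shows "labelings m G \<noteq> {}"
proof -
  have "\<exists>f. inj_on f (out_arcs G x) \<and> f ` out_arcs G x \<subseteq> {1..m}" if "x \<in> verts G" for x
  proof -
    have "card (out_arcs G x) \<le> card {1..m}"
      using assms[OF that] by (simp add: out_degree_def)
    then show ?thesis
      using card_le_inj[OF finite_out_arcs, of "{1..m}"] by blast
  qed
  then obtain f where f: "\<And>x. x \<in> verts G \<Longrightarrow> inj_on (f x) (out_arcs G x)"
    "\<And>x. x \<in> verts G \<Longrightarrow> f x ` out_arcs G x \<subseteq> {1..m}"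
    by metis
  have "restrict (\<lambda>a. f (tail G a) a) (arcs G) \<in> labelings m G"
    unfolding labelings_def
  proof (intro CollectI conjI)
    show "restrict (\<lambda>a. f (tail G a) a) (arcs G) \<in> arcs G \<rightarrow>\<^sub>E {1..m}"
      using f(2) by (intro restrict_PiE_iff[THEN iffD2] ballI) (force simp: out_arcs_def)
    show "inj_on (\<lambda>a. (tail G a, restrict (\<lambda>a. f (tail G a) a) (arcs G) a)) (arcs G)"
    proof (rule inj_onI)
      fix a b assume ab: "a \<in> arcs G" "b \<in> arcs G"
        "(tail G a, restrict (\<lambda>a. f (tail G a) a) (arcs G) a) =
         (tail G b, restrict (\<lambda>a. f (tail G a) a) (arcs G) b)"
      then have "tail G a = tail G b" "f (tail G a) a = f (tail G a) b" by auto
      then show "a = b"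
        using ab inj_onD[OF f(1)[of "tail G a"], of a b] by auto
    qed
  qed
  then show ?thesis by blast
qed

lemma orderingD:
  assumes "\<pi> \<in> attainable_orderings m G"
  shows "bij_betw \<pi> (verts G) {1..card (verts G)}" "\<pi> \<in> extensional (verts G)"
    "\<And>a. a \<in> arcs G \<Longrightarrow> \<pi> (head G a) < \<pi> (tail G a)"
    "\<And>x. x \<in> verts G \<Longrightarrow> \<pi> x \<in> {1..card (verts G)}"
    "\<And>x. x \<in> verts G \<Longrightarrow> out_degree G x \<le> m"
  using assms by (auto simp: attainable_orderings_def orderings_def attainable_def bij_betw_def)

lemma placed_inj:
  assumes \<pi>: "\<pi> \<in> attainable_orderings m G" and u: "u \<in> chains (card (verts G)) n"
  shows "inj_on (\<lambda>x. u (\<pi> x)) (verts G)"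
  using comp_inj_on[of \<pi> "verts G" u] orderingD(1)[OF \<pi>] chainsD(3)[OF u]
  by (simp add: bij_betw_def comp_def)

lemma place_arc_valid:
  assumes \<pi>: "\<pi> \<in> attainable_orderings m G" and u: "u \<in> chains (card (verts G)) n"
    and g: "g \<in> labelings m G"
  shows "inj_on (place_arc G \<pi> u g) (arcs G)" "valid_edges m (place_arc G \<pi> u g ` arcs G)"
    "fst ` snd ` place_arc G \<pi> u g ` arcs G \<subseteq> {..n}"
proof -
  have inj: "inj_on (\<lambda>a. snd (place_arc G \<pi> u g a)) (arcs G)"
  proof (rule inj_onI)
    fix a b assume ab: "a \<in> arcs G" "b \<in> arcs G"
      "snd (place_arc G \<pi> u g a) = snd (place_arc G \<pi> u g b)"
    then have "tail G a = tail G b" "g a = g b"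
      using inj_onD[OF placed_inj[OF \<pi> u], of "tail G a" "tail G b"] by (auto simp: place_arc_def)
    then show "a = b"
      using g ab by (auto simp: labelings_def dest: inj_onD)
  qed
  then show "inj_on (place_arc G \<pi> u g) (arcs G)"
    by (auto simp: inj_on_def)
  have ends: "1 \<le> u (\<pi> (head G a))" "u (\<pi> (head G a)) < u (\<pi> (tail G a))" "u (\<pi> (tail G a)) \<le> n"
    "g a \<in> {1..m}" if "a \<in> arcs G" for a
    using that orderingD(3,4)[OF \<pi>] chainsD(1,2)[OF u] g by (auto simp: labelings_def)
  have "inj_on snd (place_arc G \<pi> u g ` arcs G)"
    using inj by (intro inj_on_imageI) (simp add: comp_def)
  then show "valid_edges m (place_arc G \<pi> u g ` arcs G)"
    using ends by (auto simp: valid_edges_def place_arc_def)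
  show "fst ` snd ` place_arc G \<pi> u g ` arcs G \<subseteq> {..n}"
    using ends by (auto simp: place_arc_def)
qed

lemma prod_arcs_head:
  fixes F :: "'a \<Rightarrow> real"
  shows "(\<Prod>a\<in>arcs G. F (head G a)) = (\<Prod>x\<in>verts G. F x ^ in_degree G x)"
proof -
  have "(\<Prod>a\<in>arcs G. F (head G a)) = (\<Prod>x\<in>verts G. \<Prod>a\<in>{a \<in> arcs G. head G a = x}. F (head G a))"
    by (rule prod.group[symmetric]) auto
  then show ?thesis by (simp add: in_degree_def in_arcs_def)
qed

lemma prod_arcs_tail:
  fixes F :: "'a \<Rightarrow> real"
  shows "(\<Prod>a\<in>arcs G. F (tail G a)) = (\<Prod>x\<in>verts G. F x ^ out_degree G x)"
proof -
  have "(\<Prod>a\<in>arcs G. F (tail G a)) = (\<Prod>x\<in>verts G. \<Prod>a\<in>{a \<in> arcs G. tail G a = x}. F (tail G a))"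
    by (rule prod.group[symmetric]) auto
  then show ?thesis by (simp add: out_degree_def out_arcs_def)
qed

text \<open>A vertex collects \<open>- \<kappa>\<close> from each in-arc and
  \<open>\<kappa> - 1\<close> from each out-arc. With \<open>1 - \<kappa>\<close> for the fraction
  in \<open>beta\<close>, the total is exactly \<open>beta \<tau> G x\<close>.\<close>

lemma prod_placed_arcs:
  assumes \<pi>: "\<pi> \<in> attainable_orderings m G" and u: "u \<in> chains (card (verts G)) n"
    and g: "g \<in> labelings m G" and \<tau>: "(\<tau> - 2) / (\<tau> - 1) = 1 - \<kappa>"
  shows "(\<Prod>(x, v, l)\<in>place_arc G \<pi> u g ` arcs G. real x powr - \<kappa> * real v powr (\<kappa> - 1)) =
    (\<Prod>i=1..card (verts G). real (u i) powr beta \<tau> G (inv_into (verts G) \<pi> i))"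
proof -
  define w where "w x = real (u (\<pi> x))" for x
  have w: "w x > 0" if "x \<in> verts G" for x
    using chainsD(1)[OF u orderingD(4)[OF \<pi> that]] by (simp add: w_def)
  have "(\<Prod>(x, v, l)\<in>place_arc G \<pi> u g ` arcs G. real x powr - \<kappa> * real v powr (\<kappa> - 1)) =
      (\<Prod>a\<in>arcs G. w (head G a) powr - \<kappa> * w (tail G a) powr (\<kappa> - 1))"
    by (subst prod.reindex[OF place_arc_valid(1)[OF \<pi> u g]]) (simp add: place_arc_def w_def)
  also have "\<dots> = (\<Prod>x\<in>verts G. (w x powr - \<kappa>) ^ in_degree G x) *
      (\<Prod>x\<in>verts G. (w x powr (\<kappa> - 1)) ^ out_degree G x)"
    by (simp add: prod.distrib prod_arcs_head[of "\<lambda>x. w x powr - \<kappa>"]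
        prod_arcs_tail[of "\<lambda>x. w x powr (\<kappa> - 1)"])
  also have "\<dots> = (\<Prod>x\<in>verts G. w x powr beta \<tau> G x)"
    unfolding prod.distrib[symmetric]
  proof (intro prod.cong refl)
    fix x assume "x \<in> verts G"
    have "beta \<tau> G x = - \<kappa> * real (in_degree G x) + (\<kappa> - 1) * real (out_degree G x)"
      unfolding beta_def \<tau> by (simp add: algebra_simps)
    then show "(w x powr - \<kappa>) ^ in_degree G x * (w x powr (\<kappa> - 1)) ^ out_degree G x = w x powr beta \<tau> G x"
      using w[OF \<open>x \<in> verts G\<close>] by (simp only: powr_power powr_add mult_ac)
  qed
  also have "\<dots> = (\<Prod>x\<in>verts G. real (u (\<pi> x)) powr beta \<tau> G (inv_into (verts G) \<pi> (\<pi> x)))"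
    using orderingD(1)[OF \<pi>] by (intro prod.cong refl) (simp add: w_def bij_betw_def)
  also have "\<dots> = (\<Prod>i=1..card (verts G). real (u i) powr beta \<tau> G (inv_into (verts G) \<pi> i))"
    by (rule prod.reindex_bij_betw[OF orderingD(1)[OF \<pi>]])
  finally show ?thesis .
qed

lemma place_arcs_copy:
  assumes \<pi>: "\<pi> \<in> attainable_orderings m G" and u: "u \<in> chains (card (verts G)) t"
    and g: "g \<in> labelings m G" and sub: "place_arc G \<pi> u g ` arcs G \<subseteq> S"
  shows "(u ` {1..card (verts G)}, place_arc G \<pi> u g ` arcs G) \<in> copies_in t S G"
proof -
  define V where "V = u ` {1..card (verts G)}"
  define p where "p = place_arc G \<pi> u g"
  define w where "w = (\<lambda>x. u (\<pi> x))"
  have inj_w: "inj_on w (verts G)" unfolding w_def by (rule placed_inj[OF \<pi> u])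
  have inj_p: "inj_on p (arcs G)" unfolding p_def by (rule place_arc_valid(1)[OF \<pi> u g])
  have V: "V = w ` verts G"
    using bij_betw_imp_surj_on[OF orderingD(1)[OF \<pi>]] by (simp only: V_def w_def image_image[symmetric])
  have p_eq: "p a = (w (head G a), w (tail G a), g a)" for a
    by (simp add: p_def place_arc_def w_def)
  \<comment> \<open>The isomorphism runs from the copy back to \<open>G\<close>. Its end maps are
    literally \<open>head G\<close> and \<open>tail G\<close>, because the image must equal
    \<open>G\<close> as a record.\<close>
  define hom where "hom = \<lparr>iso_verts = inv_into (verts G) w, iso_arcs = inv_into (arcs G) p,
    iso_head = head G, iso_tail = tail G\<rparr>"
  have "pre_digraph.digraph_isomorphism (edge_digraph V (p ` arcs G)) hom"
    unfolding pre_digraph.digraph_isomorphism_def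
  proof (intro conjI ballI)
    show "wf_digraph (edge_digraph V (p ` arcs G))"
      by unfold_locales (auto simp: edge_digraph_def V p_eq)
    show "inj_on (iso_verts hom) (verts (edge_digraph V (p ` arcs G)))"
      by (simp add: hom_def edge_digraph_def V inj_on_inv_into)
    show "inj_on (iso_arcs hom) (arcs (edge_digraph V (p ` arcs G)))"
      by (simp add: hom_def edge_digraph_def inj_on_inv_into)
  next
    fix e assume "e \<in> arcs (edge_digraph V (p ` arcs G))"
    then obtain a where a: "a \<in> arcs G" "e = p a" by (auto simp: edge_digraph_def)
    then show "iso_verts hom (tail (edge_digraph V (p ` arcs G)) e) = iso_tail hom (iso_arcs hom e)"
      "iso_verts hom (head (edge_digraph V (p ` arcs G)) e) = iso_head hom (iso_arcs hom e)"
      using inj_p inj_w by (simp_all add: hom_def edge_digraph_def p_eq[of a, symmetric])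
        (simp_all add: p_eq)
  qed
  moreover have "G = app_iso hom (edge_digraph V (p ` arcs G))"
    using inj_p inj_w
    by (simp add: app_iso_def hom_def edge_digraph_def V inv_into_image_cancel)
  ultimately have "digraph_iso (edge_digraph V (p ` arcs G)) G"
    unfolding digraph_iso_def by blast
  moreover have "V \<subseteq> {1..t}"
    using chainsD(1)[OF u] unfolding V_def by blast
  moreover have "card V = card (verts G)"
    using chainsD(3)[OF u] by (simp add: V_def card_image)
  moreover have "\<forall>(x, v, j)\<in>p ` arcs G. x \<in> V \<and> v \<in> V"
    by (auto simp: p_eq V)
  ultimately show ?thesis
    using sub by (simp add: copies_in_def V_def p_def)
qed

text \<open>Surjectivity of placement. The assumption \<open>older\<close> is all that is used of
  the random graph: edges point to older vertices, labels are in range, and \<open>e\<close> makes a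
  slot determine its endpoint.\<close>

lemma copies_in_placed:
  assumes older: "\<And>x v l. (x, v, l) \<in> S \<Longrightarrow> x < v \<and> l \<in> {1..m} \<and> e v l = x"
    and copy: "(V, A) \<in> copies_in t S G"
  obtains \<pi> u g where "\<pi> \<in> attainable_orderings m G" "u \<in> chains (card (verts G)) t"
    "g \<in> labelings m G" "place_arc G \<pi> u g ` arcs G \<subseteq> S"
    "V = u ` {1..card (verts G)}" "A = place_arc G \<pi> u g ` arcs G"
proof -
  let ?k = "card (verts G)"
  let ?D = "edge_digraph V A"
  have V: "V \<subseteq> {1..t}" "card V = ?k" and A: "A \<subseteq> S" "\<And>x v l. (x, v, l) \<in> A \<Longrightarrow> x \<in> V \<and> v \<in> V"
    using copy by (auto simp: copies_in_def)
  obtain hom where hom: "pre_digraph.digraph_isomorphism ?D hom" and G: "G = app_iso hom ?D"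
    using copy by (auto simp: copies_in_def digraph_iso_def)
  define \<phi> \<psi> where "\<phi> = iso_verts hom" and "\<psi> = iso_arcs hom"
  have \<phi>: "inj_on \<phi> V" "\<phi> ` V = verts G" and \<psi>: "inj_on \<psi> A" "\<psi> ` A = arcs G"
    using hom unfolding pre_digraph.digraph_isomorphism_def
    by (auto simp: G \<phi>_def \<psi>_def edge_digraph_def)
  have ends: "tail G (\<psi> (x, v, l)) = \<phi> v" "head G (\<psi> (x, v, l)) = \<phi> x" if "(x, v, l) \<in> A" for x v l
    using hom that unfolding pre_digraph.digraph_isomorphism_def
    by (auto simp: G \<phi>_def \<psi>_def edge_digraph_def)
  obtain u where u: "u \<in> chains ?k t" "u ` {1..?k} = V"
    using chains_enumerate[OF V] .
  have inj_u: "inj_on u {1..?k}" by (rule chainsD(3)[OF u(1)])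
  \<comment> \<open>The ordering is the rank of the corresponding vertex of the copy; the labels are
    read off the edges themselves.\<close>
  define \<pi> where "\<pi> = restrict (\<lambda>x. inv_into {1..?k} u (inv_into V \<phi> x)) (verts G)"
  define g where "g = restrict (\<lambda>a. snd (snd (inv_into A \<psi> a))) (arcs G)"
  have \<pi>_\<phi>: "u (\<pi> (\<phi> v)) = v" "\<pi> (\<phi> v) \<in> {1..?k}" if "v \<in> V" for v
  proof -
    have "\<phi> v \<in> verts G" using \<phi> that by auto
    moreover have "inv_into V \<phi> (\<phi> v) = v" using \<phi> that by simp
    ultimately have *: "\<pi> (\<phi> v) = inv_into {1..?k} u v" by (simp add: \<pi>_def)
    have "v \<in> u ` {1..?k}" using that u(2) by simp
    then show "u (\<pi> (\<phi> v)) = v" "\<pi> (\<phi> v) \<in> {1..?k}"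
      unfolding * by (rule f_inv_into_f, rule inv_into_into)
  qed
  have bij: "bij_betw \<pi> (verts G) {1..?k}"
  proof -
    have "inj_on \<pi> (verts G)"
    proof (rule inj_onI)
      fix x y assume xy: "x \<in> verts G" "y \<in> verts G" "\<pi> x = \<pi> y"
      then obtain v w where vw: "x = \<phi> v" "y = \<phi> w" "v \<in> V" "w \<in> V"
        using \<phi>(2) by blast
      have "v = u (\<pi> x)" unfolding vw(1) using \<pi>_\<phi>(1)[OF vw(3)] by (rule sym)
      also have "\<dots> = u (\<pi> y)" unfolding xy(3) ..
      also have "\<dots> = w" unfolding vw(2) by (rule \<pi>_\<phi>(1)[OF vw(4)])
      finally show "x = y" unfolding vw by (rule arg_cong)
    qed
    moreover have "\<pi> ` verts G \<subseteq> {1..?k}"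
    proof (rule image_subsetI)
      fix x assume "x \<in> verts G"
      then obtain v where "x = \<phi> v" "v \<in> V" using \<phi>(2) by blast
      then show "\<pi> x \<in> {1..?k}" using \<pi>_\<phi>(2) by (simp only:)
    qed
    moreover have "card (\<pi> ` verts G) = card {1..?k}"
      using card_image[OF calculation(1)] by simp
    ultimately have "\<pi> ` verts G = {1..?k}" by (intro card_subset_eq) auto
    then show ?thesis
      using \<open>inj_on \<pi> (verts G)\<close> by (simp only: bij_betw_def simp_thms)
  qed
  have arc: "\<exists>x v l. (x, v, l) \<in> A \<and> a = \<psi> (x, v, l) \<and> g a = l \<and> tail G a = \<phi> v \<and> head G a = \<phi> x \<and>
      place_arc G \<pi> u g a = (x, v, l) \<and> x < v \<and> l \<in> {1..m} \<and> e v l = x" if "a \<in> arcs G" for a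
  proof -
    have "a \<in> \<psi> ` A" unfolding \<psi>(2) by (rule that)
    then obtain y where y: "y \<in> A" "a = \<psi> y" by (elim imageE)
    obtain x v l where "y = (x, v, l)" by (cases y)
    with y have xvl: "(x, v, l) \<in> A" "a = \<psi> (x, v, l)" by auto
    then have "inv_into A \<psi> a = (x, v, l)" using \<psi>(1) by simp
    then have "g a = l" using that by (simp add: g_def)
    moreover have "tail G a = \<phi> v" "head G a = \<phi> x" using ends[OF xvl(1)] xvl(2) by auto
    moreover have "place_arc G \<pi> u g a = (x, v, l)"
      using calculation \<pi>_\<phi>(1) A(2)[OF xvl(1)] by (simp add: place_arc_def)
    ultimately show ?thesis
      using xvl older[of x v l] A(1) by blast
  qed
  have g_mem: "g \<in> labelings m G"
    unfolding labelings_def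
  proof (intro CollectI conjI PiE_I inj_onI)
    fix a assume "a \<in> arcs G"
    then show "g a \<in> {1..m}" using arc by blast
  next
    fix a assume "a \<notin> arcs G"
    then show "g a = undefined" by (simp add: g_def)
  next
    fix a b assume ab: "a \<in> arcs G" "b \<in> arcs G" "(tail G a, g a) = (tail G b, g b)"
    obtain x v l where a: "(x, v, l) \<in> A" "a = \<psi> (x, v, l)" "g a = l" "tail G a = \<phi> v" "e v l = x"
      using arc[OF ab(1)] by blast
    obtain x' v' l' where b: "(x', v', l') \<in> A" "b = \<psi> (x', v', l')" "g b = l'" "tail G b = \<phi> v'" "e v' l' = x'"
      using arc[OF ab(2)] by blast
    \<comment> \<open>The slots coincide, hence also the endpoints \<open>x\<close> and
      \<open>x'\<close>, both being \<open>e v l\<close>; so the two arcs have the same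
      preimage.\<close>
    have "v = v'" "l = l'"
      using ab(3) a b A(2)[OF a(1)] A(2)[OF b(1)] inj_onD[OF \<phi>(1), of v v'] by auto
    then show "a = b" using a b by simp
  qed
  have "\<pi> \<in> attainable_orderings m G"
    unfolding attainable_orderings_def orderings_def attainable_def
  proof (intro CollectI conjI ballI)
    show "\<pi> \<in> extensional (verts G)" by (simp add: \<pi>_def)
    show "bij_betw \<pi> (verts G) {1..?k}" by (rule bij)
  next
    fix a assume "a \<in> arcs G"
    then obtain x v l where xvl: "(x, v, l) \<in> A" "tail G a = \<phi> v" "head G a = \<phi> x" "x < v"
      using arc by blast
    show "\<pi> (head G a) < \<pi> (tail G a)"
    proof (rule ccontr)
      assume "\<not> \<pi> (head G a) < \<pi> (tail G a)"
      then have "\<pi> (\<phi> v) < \<pi> (\<phi> x) \<or> \<pi> (\<phi> v) = \<pi> (\<phi> x)" using xvl by auto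
      then have "u (\<pi> (\<phi> v)) \<le> u (\<pi> (\<phi> x))"
        using chainsD(2)[OF u(1) \<pi>_\<phi>(2) \<pi>_\<phi>(2), of v x] A(2)[OF xvl(1)] by auto
      then show False using \<pi>_\<phi>(1) A(2)[OF xvl(1)] xvl(4) by simp
    qed
  next
    fix x assume "x \<in> verts G"
    \<comment> \<open>On arcs with a common tail the labels alone are distinct, and there are only
      \<open>m\<close> of them.\<close>
    have "inj_on g (out_arcs G x)"
      using g_mem by (auto simp: labelings_def inj_on_def)
    moreover have "g ` out_arcs G x \<subseteq> {1..m}"
      using g_mem by (auto simp: labelings_def)
    ultimately show "out_degree G x \<le> m"
      unfolding out_degree_def using card_inj_on_le[of g "out_arcs G x" "{1..m}"] by simp
  qed
  moreover have "A = place_arc G \<pi> u g ` arcs G"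
  proof
    show "place_arc G \<pi> u g ` arcs G \<subseteq> A"
      using arc by (metis image_subsetI)
    show "A \<subseteq> place_arc G \<pi> u g ` arcs G"
    proof
      fix y assume y: "y \<in> A"
      then have "\<psi> y \<in> arcs G" unfolding \<psi>(2)[symmetric] by (rule imageI)
      then obtain z where z: "z \<in> A" "\<psi> y = \<psi> z" "place_arc G \<pi> u g (\<psi> y) = z"
        using arc by blast
      then have "y = z" using \<psi>(1) y by (auto dest: inj_onD)
      then show "y \<in> place_arc G \<pi> u g ` arcs G" using z \<open>\<psi> y \<in> arcs G\<close> by (metis imageI)
    qed
  qed
  ultimately show thesis
    using that[of \<pi> u g] u g_mem A(1) by simp
qed

text \<open>Only an inequality: for instance, exchanging the labels of two parallel arcs changes the
  labeling but not the copy.\<close>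

lemma card_copies_le:
  assumes older: "\<And>x v l. (x, v, l) \<in> S \<Longrightarrow> x < v \<and> l \<in> {1..m} \<and> e v l = x"
  shows "card (copies_in t S G) \<le> (\<Sum>\<pi>\<in>attainable_orderings m G. \<Sum>g\<in>labelings m G.
    \<Sum>u\<in>chains (card (verts G)) t. of_bool (place_arc G \<pi> u g ` arcs G \<subseteq> S))"
proof -
  let ?I = "attainable_orderings m G \<times> labelings m G \<times> chains (card (verts G)) t"
  let ?J = "{(\<pi>, g, u) \<in> ?I. place_arc G \<pi> u g ` arcs G \<subseteq> S}"
  have fin: "finite ?I"
    by (simp add: finite_attainable_orderings finite_labelings finite_chains)
  have "copies_in t S G \<subseteq> (\<lambda>(\<pi>, g, u). (u ` {1..card (verts G)}, place_arc G \<pi> u g ` arcs G)) ` ?J"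
  proof safe
    fix V A assume "(V, A) \<in> copies_in t S G"
    then obtain \<pi> u g where "\<pi> \<in> attainable_orderings m G" "u \<in> chains (card (verts G)) t"
      "g \<in> labelings m G" "place_arc G \<pi> u g ` arcs G \<subseteq> S"
      "V = u ` {1..card (verts G)}" "A = place_arc G \<pi> u g ` arcs G"
      using copies_in_placed[of S m e V A t] older by blast
    then show "(V, A) \<in> (\<lambda>(\<pi>, g, u). (u ` {1..card (verts G)}, place_arc G \<pi> u g ` arcs G)) ` ?J"
      by (intro image_eqI[of _ _ "(\<pi>, g, u)"]) auto
  qed
  moreover have finJ: "finite ?J" using fin by (rule finite_subset[rotated]) auto
  ultimately have "card (copies_in t S G) \<le> card ?J"
    by (meson card_image_le card_mono finite_imageI le_trans)
  also have "card ?J = card {p \<in> ?I. place_arc G (fst p) (snd (snd p)) (fst (snd p)) ` arcs G \<subseteq> S}"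
    by (rule arg_cong[where f = card]) auto
  also have "\<dots> = (\<Sum>p\<in>?I. of_bool (place_arc G (fst p) (snd (snd p)) (fst (snd p)) ` arcs G \<subseteq> S))"
    using fin by (simp add: sum_of_bool_eq Int_def)
  also have "\<dots> = (\<Sum>\<pi>\<in>attainable_orderings m G. \<Sum>g\<in>labelings m G.
    \<Sum>u\<in>chains (card (verts G)) t. of_bool (place_arc G \<pi> u g ` arcs G \<subseteq> S))"
    by (simp add: sum.cartesian_product split_def)
  finally show ?thesis .
qed

text \<open>With ordering and labeling fixed there is no overcounting, since the vertex set already
  determines the chain.\<close>

lemma card_copies_ge:
  assumes \<pi>: "\<pi> \<in> attainable_orderings m G" and g: "g \<in> labelings m G" and S: "finite S"
  shows "(\<Sum>u\<in>chains (card (verts G)) t. of_bool (place_arc G \<pi> u g ` arcs G \<subseteq> S)) \<le>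
    card (copies_in t S G)"
proof -
  let ?J = "{u \<in> chains (card (verts G)) t. place_arc G \<pi> u g ` arcs G \<subseteq> S}"
  let ?f = "\<lambda>u. (u ` {1..card (verts G)}, place_arc G \<pi> u g ` arcs G)"
  have "copies_in t S G \<subseteq> Pow {1..t} \<times> Pow S"
    by (auto simp: copies_in_def)
  then have fin: "finite (copies_in t S G)"
    by (rule finite_subset) (simp add: S)
  have "inj_on ?f ?J"
    using chains_image_inj[of "card (verts G)" t] by (auto simp: inj_on_def)
  moreover have "?f ` ?J \<subseteq> copies_in t S G"
    using place_arcs_copy[OF \<pi> _ g] by auto
  ultimately have "card ?J \<le> card (copies_in t S G)"
    using fin by (rule card_inj_on_le)
  then show ?thesis
    by (simp add: sum_of_bool_eq finite_chains Int_def)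
qed

end

context pa_model
begin

text \<open>Lower bounds hold for each ordering separately, the upper bound for the sum over
  orderings. Up to constants this is the same, as there are finitely many orderings and the dominant
  one decides.\<close>

lemma expectation_copies_bounds:
  fixes H :: "('c, 'd) pre_digraph"
  assumes H: "fin_digraph H" and \<tau>: "(\<tau> - 2) / (\<tau> - 1) = 1 - \<kappa>"
  defines "W \<equiv> \<lambda>\<pi> t. chain_sum (\<lambda>i. beta \<tau> H (inv_into (verts H) \<pi> i)) (card (verts H)) t"
  defines "X \<equiv> \<lambda>t. expectation (\<lambda>\<omega>. real (num_copies m (\<lambda>v j. E v j \<omega>) t H))"
  shows "\<exists>c C. 0 < c \<and> 0 < C \<and> (\<forall>\<pi>\<in>attainable_orderings m H. \<forall>t\<ge>2. c * W \<pi> t \<le> X t) \<and>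
    (\<forall>t\<ge>2. X t \<le> C * (\<Sum>\<pi>\<in>attainable_orderings m H. W \<pi> t))"
proof -
  interpret H: fin_digraph H by fact
  let ?k = "card (verts H)" and ?O = "attainable_orderings m H" and ?L = "labelings m H"
  let ?R = "\<lambda>\<pi> g u. place_arc H \<pi> u g ` arcs H"
  let ?P = "\<lambda>\<pi> g u t. prob {\<omega> \<in> space M. ?R \<pi> g u \<subseteq> hist t 0 \<omega>}"
  obtain c C where c: "0 < c" "0 < C"
    "\<And>R N. valid_edges m R \<Longrightarrow> card R \<le> card (arcs H) \<Longrightarrow> N \<ge> 2 \<Longrightarrow> fst ` snd ` R \<subseteq> {..N} \<Longrightarrow>
       c * (\<Prod>(u, v, l)\<in>R. real u powr - \<kappa> * real v powr (\<kappa> - 1)) \<le>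
         prob {\<omega> \<in> space M. R \<subseteq> hist N 0 \<omega>}"
    "\<And>R N. valid_edges m R \<Longrightarrow> card R \<le> card (arcs H) \<Longrightarrow> N \<ge> 2 \<Longrightarrow> fst ` snd ` R \<subseteq> {..N} \<Longrightarrow>
       prob {\<omega> \<in> space M. R \<subseteq> hist N 0 \<omega>} \<le>
         C * (\<Prod>(u, v, l)\<in>R. real u powr - \<kappa> * real v powr (\<kappa> - 1))"
    using prob_edges_bounds[of "card (arcs H)"] by blast
  have P: "c * (\<Prod>i=1..?k. real (u i) powr beta \<tau> H (inv_into (verts H) \<pi> i)) \<le> ?P \<pi> g u t"
    "?P \<pi> g u t \<le> C * (\<Prod>i=1..?k. real (u i) powr beta \<tau> H (inv_into (verts H) \<pi> i))"
    if "\<pi> \<in> ?O" "g \<in> ?L" "u \<in> chains ?k t" "t \<ge> 2" for \<pi> g u t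
    using c(3,4)[of "?R \<pi> g u" t] H.place_arc_valid[OF that(1,3,2)] that(4)
      H.prod_placed_arcs[OF that(1,3,2) \<tau>] card_image_le[OF H.finite_arcs, of "place_arc H \<pi> u g"]
    by simp_all
  have sumP: "c * W \<pi> t \<le> (\<Sum>u\<in>chains ?k t. ?P \<pi> g u t)"
    "(\<Sum>u\<in>chains ?k t. ?P \<pi> g u t) \<le> C * W \<pi> t"
    if "\<pi> \<in> ?O" "g \<in> ?L" "t \<ge> 2" for \<pi> g t
    unfolding W_def sum_chains[symmetric] sum_distrib_left
    using P that by (auto intro!: sum_mono)
  have X: "X t = expectation (\<lambda>\<omega>. real (card (copies_in t (hist t 0 \<omega>) H)))" for t
    unfolding X_def num_copies_eq hist_def ..
  have expect: "expectation (\<lambda>\<omega>. \<Sum>u\<in>chains ?k t. of_bool (?R \<pi> g u \<subseteq> hist t 0 \<omega>)) =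
      (\<Sum>u\<in>chains ?k t. ?P \<pi> g u t)"
    "integrable M (\<lambda>\<omega>. \<Sum>u\<in>chains ?k t. of_bool (?R \<pi> g u \<subseteq> hist t 0 \<omega>) :: real)"
    if "t \<ge> 2" for \<pi> g t
  proof -
    have int: "integrable M (\<lambda>\<omega>. of_bool (?R \<pi> g u \<subseteq> hist t 0 \<omega>) :: real)" for u
      using integrable_hist[of t 0 "\<lambda>S. of_bool (?R \<pi> g u \<subseteq> S)"] that by simp
    have "expectation (\<lambda>\<omega>. of_bool (?R \<pi> g u \<subseteq> hist t 0 \<omega>)) = ?P \<pi> g u t" for u
    proof -
      have "expectation (\<lambda>\<omega>. of_bool (?R \<pi> g u \<subseteq> hist t 0 \<omega>)) =
          expectation (indicator {\<omega> \<in> space M. ?R \<pi> g u \<subseteq> hist t 0 \<omega>})"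
        by (intro Bochner_Integration.integral_cong) (auto simp: indicator_def)
      also have "\<dots> = ?P \<pi> g u t" by (auto intro!: arg_cong[where f = prob])
      finally show ?thesis .
    qed
    then show "expectation (\<lambda>\<omega>. \<Sum>u\<in>chains ?k t. of_bool (?R \<pi> g u \<subseteq> hist t 0 \<omega>)) =
      (\<Sum>u\<in>chains ?k t. ?P \<pi> g u t)"
      using int by (simp add: Bochner_Integration.integral_sum)
    show "integrable M (\<lambda>\<omega>. \<Sum>u\<in>chains ?k t. of_bool (?R \<pi> g u \<subseteq> hist t 0 \<omega>) :: real)"
      using int by (rule Bochner_Integration.integrable_sum)
  qed
  have int_copies: "integrable M (\<lambda>\<omega>. real (card (copies_in t (hist t 0 \<omega>) H)))" if "t \<ge> 2" for t
    using integrable_hist[of t 0 "\<lambda>S. real (card (copies_in t S H))"] that by simp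
  have lower: "c * W \<pi> t \<le> X t" if \<pi>: "\<pi> \<in> ?O" and t: "t \<ge> 2" for \<pi> t
  proof -
    obtain g where g: "g \<in> ?L"
      using H.labelings_nonempty[OF H.orderingD(5)[OF \<pi>]] by blast
    have "(\<Sum>u\<in>chains ?k t. ?P \<pi> g u t) \<le> X t"
      unfolding X expect(1)[OF t, symmetric]
    proof (intro integral_mono expect(2) int_copies t)
      fix \<omega> assume "\<omega> \<in> space M"
      then have "finite (hist t 0 \<omega>)" using fresh_hist(1)[of t 0 \<omega>] t by simp
      from H.card_copies_ge[OF \<pi> g this, of t]
      have "real (\<Sum>u\<in>chains ?k t. of_bool (?R \<pi> g u \<subseteq> hist t 0 \<omega>)) \<le>
          real (card (copies_in t (hist t 0 \<omega>) H))"
        by (rule of_nat_mono)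
      then show "(\<Sum>u\<in>chains ?k t. of_bool (?R \<pi> g u \<subseteq> hist t 0 \<omega>)) \<le>
          real (card (copies_in t (hist t 0 \<omega>) H))"
        by simp
    qed
    then show ?thesis using sumP(1)[OF \<pi> g t] by linarith
  qed
  \<comment> \<open>The added 1 keeps the constant positive even if there are no labelings.\<close>
  have upper: "X t \<le> (C * real (card ?L) + 1) * (\<Sum>\<pi>\<in>?O. W \<pi> t)" if t: "t \<ge> 2" for t
  proof -
    have "X t \<le> expectation (\<lambda>\<omega>. \<Sum>\<pi>\<in>?O. \<Sum>g\<in>?L. \<Sum>u\<in>chains ?k t. of_bool (?R \<pi> g u \<subseteq> hist t 0 \<omega>))"
      unfolding X
    proof (intro integral_mono int_copies t Bochner_Integration.integrable_sum[OF Bochner_Integration.integrable_sum] expect(2))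
      fix \<omega> assume \<omega>: "\<omega> \<in> space M"
      have "x < v \<and> l \<in> {1..m} \<and> E v l \<omega> = x" if "(x, v, l) \<in> hist t 0 \<omega>" for x v l
        using that E_older[of v l \<omega>] \<omega> t unfolding hist_def pa_partial_def by force
      from of_nat_mono[OF H.card_copies_le[OF this, where t = t], where 'a = real]
      show "real (card (copies_in t (hist t 0 \<omega>) H)) \<le>
          (\<Sum>\<pi>\<in>?O. \<Sum>g\<in>?L. \<Sum>u\<in>chains ?k t. of_bool (?R \<pi> g u \<subseteq> hist t 0 \<omega>))"
        by simp
    qed
    also have "\<dots> = (\<Sum>\<pi>\<in>?O. \<Sum>g\<in>?L. \<Sum>u\<in>chains ?k t. ?P \<pi> g u t)"
      using expect[OF t]
      by (simp only: Bochner_Integration.integral_sum Bochner_Integration.integrable_sum)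
    also have "\<dots> \<le> (\<Sum>\<pi>\<in>?O. \<Sum>g\<in>?L. C * W \<pi> t)"
      using sumP(2) t by (intro sum_mono)
    also have "\<dots> = C * real (card ?L) * (\<Sum>\<pi>\<in>?O. W \<pi> t)"
      by (simp add: sum_distrib_left mult_ac)
    also have "\<dots> \<le> (C * real (card ?L) + 1) * (\<Sum>\<pi>\<in>?O. W \<pi> t)"
      unfolding W_def by (intro mult_right_mono sum_nonneg chain_sum_nonneg) simp
    finally show ?thesis .
  qed
  have "0 < C * real (card ?L) + 1" using c(2) by (simp add: add_nonneg_pos)
  then show ?thesis
    using c(1) lower upper by blast
qed

end

section \<open>Translation into \<open>B_graph\<close> and \<open>r_star\<close>, and the final
  bounds\<close>

lemma power_log_bigo:
  fixes a b :: real and p q :: nat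
  assumes "a < b \<or> a = b \<and> p \<le> q"
  shows "(\<lambda>t::nat. real t powr a * ln (real t) ^ p) \<in> O(\<lambda>t. real t powr b * ln (real t) ^ q)"
proof -
  have *: "(\<lambda>t::nat. real t powr b * ln (real t) ^ p') \<in> O(\<lambda>t. real t powr b * ln (real t) ^ q)"
    if "p' \<le> q" for p'
  proof (rule bigoI[of _ 1])
    have "eventually (\<lambda>t::nat. ln (real t) \<ge> 1) sequentially" by real_asymp
    then show "eventually (\<lambda>t. norm (real t powr b * ln (real t) ^ p') \<le>
        1 * norm (real t powr b * ln (real t) ^ q)) sequentially"
    proof eventually_elim
      case (elim t)
      then have "ln (real t) ^ p' \<le> ln (real t) ^ q" using that by (intro power_increasing) auto
      then show ?case using elim by (simp add: abs_mult mult_left_mono)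
    qed
  qed
  show ?thesis
    using assms
  proof
    assume "a < b"
    then have "(\<lambda>t::nat. real t powr a * ln (real t) ^ p) \<in> O(\<lambda>t. real t powr b)"
      by real_asymp
    also have "(\<lambda>t::nat. real t powr b) \<in> O(\<lambda>t. real t powr b * ln (real t) ^ q)"
      using *[of 0] by simp
    finally show ?thesis .
  qed (use * in auto)
qed

text \<open>Adding 1 to each of the \<open>k - s\<close> summands turns the term with index
  \<open>s\<close> into \<open>k + B_term \<tau> H \<pi> s\<close>, a shift that is the same for all
  \<open>s\<close>. Maximizers are thus preserved, and the logarithmic power is one less than their
  number.\<close>

lemma chain_exponent_B_ord:
  "chain_exponent (\<lambda>i. beta \<tau> H (inv_into (verts H) \<pi> i)) (card (verts H)) =
     real (card (verts H)) + B_ord \<tau> H \<pi>"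
  and chain_ties_num_maximizers:
  "Suc (chain_ties (\<lambda>i. beta \<tau> H (inv_into (verts H) \<pi> i)) (card (verts H))) = num_maximizers \<tau> H \<pi>"
proof -
  let ?k = "card (verts H)" and ?b = "\<lambda>i. beta \<tau> H (inv_into (verts H) \<pi> i)"
  have S: "(\<Sum>i=s+1..?k. 1 + ?b i) = real ?k + B_term \<tau> H \<pi> s" if "s \<in> {0..?k}" for s
    using that by (simp add: B_term_def sum.distrib of_nat_diff)
  have "(\<lambda>s. \<Sum>i=s+1..?k. 1 + ?b i) ` {0..?k} = (\<lambda>y. real ?k + y) ` B_term \<tau> H \<pi> ` {0..?k}"
    unfolding image_image by (intro image_cong refl S)
  moreover have "Max ((\<lambda>y. real ?k + y) ` B_term \<tau> H \<pi> ` {0..?k}) = real ?k + Max (B_term \<tau> H \<pi> ` {0..?k})"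
    by (subst mono_Max_commute[symmetric]) (auto intro: monoI)
  ultimately show e: "chain_exponent ?b ?k = real ?k + B_ord \<tau> H \<pi>"
    unfolding chain_exponent_Max B_ord_def by simp
  have "{s \<in> {0..?k}. (\<Sum>i=s+1..?k. 1 + ?b i) = chain_exponent ?b ?k} =
      {s \<in> {0..?k}. B_term \<tau> H \<pi> s = B_ord \<tau> H \<pi>}"
    unfolding e by (intro Collect_cong conj_cong refl) (simp only: S add_left_cancel)
  then show "Suc (chain_ties ?b ?k) = num_maximizers \<tau> H \<pi>"
    unfolding chain_ties_card[symmetric] num_maximizers_def by simp
qed

theorem corollary2p3:
  fixes M :: "'w measure" and m :: nat and \<delta> \<tau> :: real
    and E :: "nat \<Rightarrow> nat \<Rightarrow> 'w \<Rightarrow> nat"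
    and H :: "('a, 'b) pre_digraph" and k :: nat
  assumes "m \<ge> 2" and "\<delta> > - real m" and "\<tau> = 3 + \<delta> / real m"
    and "preferential_attachment M m \<delta> E"
    and "fin_digraph H" and "Digraph_Component.connected H" and "card (verts H) = k"
    and "attainable_orderings m H \<noteq> {}"
  shows "\<exists>C1 C2. 0 < C1 \<and> C1 \<le> C2 \<and>
    (let q = (\<lambda>t :: nat.
       (\<integral>\<omega>. real (num_copies m (\<lambda>v j. E v j \<omega>) t H) \<partial>M)
         / (real t powr (real k + B_graph m \<tau> H) * ln (real t) ^ (r_star m \<tau> H - 1)))
     in ereal C1 \<le> liminf (\<lambda>t. ereal (q t)) \<and>
        liminf (\<lambda>t. ereal (q t)) \<le> limsup (\<lambda>t. ereal (q t)) \<and>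
        limsup (\<lambda>t. ereal (q t)) \<le> ereal C2)"
proof -
  interpret preferential_attachment M m \<delta> E by fact
  interpret pa_model M m \<delta> E
    by unfold_locales (use assms in auto)
  interpret H: fin_digraph H by fact
  let ?O = "attainable_orderings m H"
  define b :: "('a \<Rightarrow> nat) \<Rightarrow> nat \<Rightarrow> real" where "b \<pi> = (\<lambda>i. beta \<tau> H (inv_into (verts H) \<pi> i))" for \<pi>
  define W where "W \<pi> = chain_sum (b \<pi>) k" for \<pi>
  define X where "X t = expectation (\<lambda>\<omega>. real (num_copies m (\<lambda>v j. E v j \<omega>) t H))" for t
  define D where "D t = real t powr (real k + B_graph m \<tau> H) * ln (real t) ^ (r_star m \<tau> H - 1)" for t :: nat
  have finO: "finite ?O" by (rule H.finite_attainable_orderings)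
  have "\<tau> - 2 = (real m + \<delta>) / real m" "\<tau> - 1 = (2 * real m + \<delta>) / real m"
    using assms by (simp_all add: field_simps)
  then have "(\<tau> - 2) / (\<tau> - 1) = (real m + \<delta>) / (2 * real m + \<delta>)"
    using assms by simp
  also have "\<dots> = 1 - \<kappa>"
    using assms by (simp add: \<kappa>_def field_simps)
  finally have \<tau>: "(\<tau> - 2) / (\<tau> - 1) = 1 - \<kappa>" .
  have "\<exists>c C. 0 < c \<and> 0 < C \<and> (\<forall>\<pi>\<in>?O. \<forall>t\<ge>2. c * W \<pi> t \<le> X t) \<and>
      (\<forall>t\<ge>2. X t \<le> C * (\<Sum>\<pi>\<in>?O. W \<pi> t))"
    using expectation_copies_bounds[OF \<open>fin_digraph H\<close> \<tau>]
    unfolding X_def W_def b_def \<open>card (verts H) = k\<close> .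
  then obtain c C where c: "0 < c" "0 < C" "\<And>\<pi> t. \<pi> \<in> ?O \<Longrightarrow> t \<ge> 2 \<Longrightarrow> c * W \<pi> t \<le> X t"
    "\<And>t. t \<ge> 2 \<Longrightarrow> X t \<le> C * (\<Sum>\<pi>\<in>?O. W \<pi> t)"
    by blast
  have W: "W \<pi> \<in> \<Theta>(\<lambda>t. real t powr (real k + B_ord \<tau> H \<pi>) * ln (real t) ^ (num_maximizers \<tau> H \<pi> - 1))" for \<pi>
  proof -
    have e: "chain_exponent (b \<pi>) k = real k + B_ord \<tau> H \<pi>"
      using chain_exponent_B_ord[of \<tau> H \<pi>] unfolding b_def \<open>card (verts H) = k\<close> .
    have "Suc (chain_ties (b \<pi>) k) = num_maximizers \<tau> H \<pi>"
      using chain_ties_num_maximizers[of \<tau> H \<pi>] unfolding b_def \<open>card (verts H) = k\<close> .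
    then have p: "chain_ties (b \<pi>) k = num_maximizers \<tau> H \<pi> - 1" by simp
    show ?thesis
      using chain_sum_bigtheta[of "b \<pi>" k] unfolding W_def e p .
  qed
  have B_le: "B_ord \<tau> H \<pi> \<le> B_graph m \<tau> H" if "\<pi> \<in> ?O" for \<pi>
    unfolding B_graph_def using that finO by (intro Max_ge) auto
  let ?B = "{\<pi> \<in> ?O. B_ord \<tau> H \<pi> = B_graph m \<tau> H}"
  have "?B \<noteq> {}"
  proof -
    have "B_graph m \<tau> H \<in> B_ord \<tau> H ` ?O"
      unfolding B_graph_def using finO assms by (intro Max_in) auto
    then show ?thesis by auto
  qed
  then have "r_star m \<tau> H \<in> num_maximizers \<tau> H ` ?B"
    unfolding r_star_def using finO by (intro Max_in) auto
  \<comment> \<open>An ordering that attains both maxima; it alone yields the lower bound.\<close>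
  then obtain \<pi>0 where \<pi>0: "\<pi>0 \<in> ?O" "B_ord \<tau> H \<pi>0 = B_graph m \<tau> H" "num_maximizers \<tau> H \<pi>0 = r_star m \<tau> H"
    by auto
  have D_pos: "eventually (\<lambda>t. D t > 0) sequentially"
    unfolding D_def using eventually_gt_at_top[of 1] by eventually_elim simp
  have "W \<pi>0 \<in> \<Theta>(D)"
    using W[of \<pi>0] unfolding \<pi>0 D_def[abs_def] .
  moreover have "eventually (\<lambda>t. W \<pi>0 t \<ge> 0) sequentially"
    by (simp add: W_def chain_sum_nonneg)
  moreover have "eventually (\<lambda>t. D t \<ge> 0) sequentially"
    using D_pos by (rule eventually_mono) (rule less_imp_le)
  ultimately have "\<exists>a a' N. 0 < a \<and> (\<forall>t\<ge>N. a * D t \<le> W \<pi>0 t \<and> W \<pi>0 t \<le> a' * D t)"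
    by (rule bigtheta_sequence_bounds)
  then obtain a a' N where "0 < a \<and> (\<forall>t\<ge>N. a * D t \<le> W \<pi>0 t \<and> W \<pi>0 t \<le> a' * D t)"
    by (elim exE)
  then have a: "0 < a" "\<And>t. t \<ge> N \<Longrightarrow> a * D t \<le> W \<pi>0 t" by auto
  \<comment> \<open>Orders of growth compare lexicographically, and \<open>r_star\<close> is the
    largest count only among orderings that attain the top exponent; orderings with a smaller
    exponent may have more logarithms.\<close>
  have "W \<pi> \<in> O(D)" if "\<pi> \<in> ?O" for \<pi>
  proof -
    have "W \<pi> \<in> O(\<lambda>t. real t powr (real k + B_ord \<tau> H \<pi>) * ln (real t) ^ (num_maximizers \<tau> H \<pi> - 1))"
      using W by auto
    also have "(\<lambda>t. real t powr (real k + B_ord \<tau> H \<pi>) * ln (real t) ^ (num_maximizers \<tau> H \<pi> - 1)) \<in> O(D)"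
      unfolding D_def[abs_def]
    proof (rule power_log_bigo)
      show "real k + B_ord \<tau> H \<pi> < real k + B_graph m \<tau> H \<or>
          real k + B_ord \<tau> H \<pi> = real k + B_graph m \<tau> H \<and> num_maximizers \<tau> H \<pi> - 1 \<le> r_star m \<tau> H - 1"
      proof (cases "B_ord \<tau> H \<pi> = B_graph m \<tau> H")
        case True
        then have "num_maximizers \<tau> H \<pi> \<le> r_star m \<tau> H"
          unfolding r_star_def using that finO by (intro Max_ge) auto
        then show ?thesis using True by simp
      next
        case False
        then show ?thesis using B_le[OF that] by simp
      qed
    qed
    finally show ?thesis .
  qed
  then have "(\<lambda>t. \<Sum>\<pi>\<in>?O. W \<pi> t) \<in> O(D)"
    by (intro big_sum_in_bigo)
  then obtain d where d: "d > 0" "eventually (\<lambda>t. norm (\<Sum>\<pi>\<in>?O. W \<pi> t) \<le> d * norm (D t)) sequentially"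
    by (elim landau_o.bigE)
  have ev: "eventually (\<lambda>t. c * a \<le> X t / D t \<and> X t / D t \<le> C * d) sequentially"
    using d(2) D_pos eventually_ge_at_top[of "max N 2"]
  proof eventually_elim
    case (elim t)
    have "c * (a * D t) \<le> c * W \<pi>0 t" using a(2) c(1) elim by (intro mult_left_mono) auto
    also have "\<dots> \<le> X t" using c(3)[OF \<pi>0(1)] elim by simp
    finally have "c * a * D t \<le> X t" by (simp add: mult_ac)
    moreover have "(\<Sum>\<pi>\<in>?O. W \<pi> t) \<le> d * D t" using elim by simp
    then have "C * (\<Sum>\<pi>\<in>?O. W \<pi> t) \<le> C * (d * D t)" using c(2) by (intro mult_left_mono) auto
    then have "X t \<le> C * d * D t" using c(4)[of t] elim by (simp add: mult_ac)
    ultimately show ?case using elim by (simp add: pos_le_divide_eq pos_divide_le_eq)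
  qed
  have lo: "ereal (c * a) \<le> liminf (\<lambda>t. ereal (X t / D t))"
    by (rule Liminf_bounded) (use ev in \<open>auto elim: eventually_mono\<close>)
  have hi: "limsup (\<lambda>t. ereal (X t / D t)) \<le> ereal (C * d)"
    by (rule Limsup_bounded) (use ev in \<open>auto elim: eventually_mono\<close>)
  have mid: "liminf (\<lambda>t. ereal (X t / D t)) \<le> limsup (\<lambda>t. ereal (X t / D t))"
    by (rule Liminf_le_Limsup) simp
  \<comment> \<open>The order of the two constants follows from the liminf and limsup lying between
    them.\<close>
  have "ereal (c * a) \<le> ereal (C * d)" using lo mid hi by (meson order_trans)
  then show ?thesis
    using lo mid hi c(1) a(1) unfolding X_def D_def Let_def
    by (intro exI[of _ "c * a"] exI[of _ "C * d"]) auto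
qed

end
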